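(* Let $K$ be a number field and let $C: y^2=f(x)$ be a hyperelliptic curve over $K$, where $f(x)\in K[x]$ has $\deg f(x)\ge 3$ and no double roots. Let $(x_i,y_i)$, $i=1,2,\ldots$, be a sequence of pairwise distinct points forming a geometric progression sequence in $C(K)$. Then the sequence $(x_i,y_i)$ is finite.
   Context: For a curve $C:y^2=f(x)$ over a number field $K$, with $f\in K[x]$ of degree at least $3$ and without double roots (such curves are called hyperelliptic here, including the cases of degree $3$ and $4$), put $C(K)=\{(x,y): y^2=f(x),\ x,y\in K\}$. A (finite or infinite) sequence $P_i=(x_i,y_i)\in C(K)$, $i=1,2,\ldots$, is a geometric progression sequence in $C(K)$ if there are $p,t\in K^{\times}$ such that $x_i=pt^i$ for all indices $i$ of the sequence. It is assumed throughout that geometric progression sequences consist of distinct points, in particular $t\notin\{1,-1\}$. *)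

theory Defs
  imports "HOL-Algebra.Algebraic_Closure_Type" "HOL-Library.Extended_Nat"
begin

text \<open>
  The field $K$ is represented by a type. It is a number field if it has a finite basis as a
  vector space over the rationals.
\<close>

definition number_field :: "'a::field_char_0 itself \<Rightarrow> bool" where
  "number_field _ \<longleftrightarrow>
     (\<exists>B::'a set. finite_dimensional_vector_space (\<lambda>(q::rat) (x::'a). of_rat q * x) B)"

text \<open>
  Double roots are excluded over the algebraic closure of $K$, not only in $K$ itself.
\<close>

definition hyperelliptic :: "'a::field_char_0 poly \<Rightarrow> bool" where
  "hyperelliptic f \<longleftrightarrow> degree f \<ge> 3 \<and> rsquarefree (map_poly to_ac f)"

definition curve_points :: "'a::field poly \<Rightarrow> ('a \<times> 'a) set" where
  "curve_points f = {(x, y). y\<^sup>2 = poly f x}"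

text \<open>
  A finite or infinite sequence of length \<open>N\<close>, indexed from 1, is a function on \<^typ>\<open>nat\<close>
  whose values outside the following index set are irrelevant.
\<close>

definition seq_indices :: "enat \<Rightarrow> nat set" where
  "seq_indices N = {i. 1 \<le> i \<and> enat i \<le> N}"

definition geometric_progression_seq ::
    "'a::field poly \<Rightarrow> enat \<Rightarrow> (nat \<Rightarrow> 'a \<times> 'a) \<Rightarrow> bool" where
  "geometric_progression_seq f N P \<longleftrightarrow>
     (\<forall>i\<in>seq_indices N. P i \<in> curve_points f) \<and>
     (\<exists>p t. p \<noteq> 0 \<and> t \<noteq> 0 \<and> (\<forall>i\<in>seq_indices N. fst (P i) = p * t ^ i))"

end

theory Submission
  imports Defs "Jordan_Normal_Form.Char_Poly"
begin

text \<open>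
  Suppose that \<open>f (p * t ^ n)\<close> is a square in the number field for all \<open>n \<ge> 1\<close>, where \<open>t\<close> is not a
  root of unity because the points are distinct. These values form a linear recurrence, and a
  recurrence with a dominant root all of whose values are squares is itself the square of a
  recurrence. The proof is Pisot's argument for this fact; no theorem on rational points of curves
  of higher genus enters.

  By Kronecker's theorem (\<open>kronecker\<close>) some absolute value \<open>s\<close> of the field satisfies \<open>s t < 1\<close>. Put
  \<open>\<tau> = t\<^sup>2\<close> and write \<open>f\<close> as a power of the variable times \<open>q\<close> with \<open>q 0 \<noteq> 0\<close>. Multiplying consecutive
  even-indexed terms shows that \<open>h = q (p * x) * q (p * \<tau> * x)\<close> has square values at all \<open>x = \<tau> ^ n\<close>,
  and \<open>h 0\<close> is the square of \<open>q 0\<close>. Hence \<open>h\<close> has a square root as a power series in \<open>x\<close>, which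
  approximates the square roots of \<open>h (\<tau> ^ n)\<close> in the field with respect to \<open>s\<close>. The theorem
  \<open>square_values_imp_square\<close> concludes that \<open>h\<close> is the square of a polynomial. A root \<open>x\<close> of
  \<open>q (p * x)\<close> is simple, so \<open>\<tau> * x\<close> must be a root as well, and the finite set of these nonzero roots
  is stable under \<open>\<tau>\<close>. This makes \<open>\<tau>\<close> a root of unity
  (\<open>product_with_dilation_square_imp_root_of_unity\<close>).

  The arithmetic of the field is developed from absolute values of its coordinates. For each
  place \<open>v\<close> of the rationals the spectral radius of the coordinate norm is a power-multiplicative
  seminorm, and a minimal seminorm below it is an absolute value
  (\<open>exists_multiplicative_seminorm\<close>); this treats the real place and the primes alike. The norm of
  the field, a determinant, is bounded by a power of the spectral radius. For an integral element it
  is an integer, and the product formula for the rationals then gives the lower bound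
  \<open>liouville_inequality\<close> for nonzero integral elements.
\<close>

section \<open>Absolute values of the rationals\<close>

definition padic_abs :: "int \<Rightarrow> rat \<Rightarrow> real" where
  "padic_abs p q = (if q = 0 then 0 else
     real_of_int p ^ multiplicity p (snd (quotient_of q)) /
     real_of_int p ^ multiplicity p (fst (quotient_of q)))"

lemma padic_abs_fraction:
  assumes "prime p" "a \<noteq> 0" "b \<noteq> 0"
  shows "padic_abs p (of_int a / of_int b) =
    real_of_int p ^ multiplicity p b / real_of_int p ^ multiplicity p a"
proof -
  define q :: rat where "q = of_int a / of_int b"
  obtain c d where cd: "quotient_of q = (c, d)" by fastforce
  have d: "d > 0" and q: "q = of_int c / of_int d"
    using quotient_of_denom_pos[OF cd] quotient_of_div[OF cd] by auto
  have "q \<noteq> 0" using assms by (simp add: q_def)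
  then have c: "c \<noteq> 0" using q by auto
  have "(of_int (a * d) :: rat) = of_int (c * b)"
    using q d assms unfolding q_def by (simp add: field_simps)
  then have "a * d = c * b" by (simp only: of_int_eq_iff)
  then have "multiplicity p a + multiplicity p d = multiplicity p c + multiplicity p b"
    using assms c d by (metis prime_elem_multiplicity_mult_distrib prime_imp_prime_elem
        less_numeral_extra(3))
  then have "real_of_int p ^ multiplicity p a * real_of_int p ^ multiplicity p d =
    real_of_int p ^ multiplicity p c * real_of_int p ^ multiplicity p b"
    by (simp flip: power_add)
  moreover have "p > 0" using assms by (simp add: prime_gt_0_int)
  ultimately show ?thesis
    using \<open>q \<noteq> 0\<close> cd unfolding q_def[symmetric] padic_abs_def by (simp add: field_simps)
qed

lemma rat_fraction: obtains a b :: int where "b > 0" "(q :: rat) = of_int a / of_int b"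
  by (metis quotient_of_denom_pos quotient_of_div surj_pair)

lemma padic_abs_nonneg: "prime p \<Longrightarrow> padic_abs p q \<ge> 0"
  unfolding padic_abs_def by (simp add: prime_ge_0_int)

lemma padic_abs_mult:
  assumes "prime p"
  shows "padic_abs p (q * r) = padic_abs p q * padic_abs p r"
proof (cases "q = 0 \<or> r = 0")
  case False
  obtain a b where 1: "b > 0" "q = of_int a / of_int b" by (rule rat_fraction)
  obtain c d where 2: "d > 0" "r = of_int c / of_int d" by (rule rat_fraction)
  have nz: "a \<noteq> 0" "c \<noteq> 0" "b \<noteq> 0" "d \<noteq> 0" using False 1 2 by auto
  have "q * r = of_int (a * c) / of_int (b * d)" using 1 2 by simp
  then show ?thesis
    using nz assms 1(2) 2(2)
    by (simp add: padic_abs_fraction prime_elem_multiplicity_mult_distrib[OF prime_imp_prime_elem]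
        power_add del: of_int_mult)
qed (auto simp: padic_abs_def)

lemma padic_abs_ultrametric:
  assumes "prime p"
  shows "padic_abs p (q + r) \<le> max (padic_abs p q) (padic_abs p r)"
proof (cases "q = 0 \<or> r = 0 \<or> q + r = 0")
  case True
  moreover have "padic_abs p 0 = 0" by (simp add: padic_abs_def)
  ultimately show ?thesis using padic_abs_nonneg[OF assms] by (metis add.left_neutral add.right_neutral
        max.cobounded1 max.cobounded2 max.coboundedI1)
next
  case False
  obtain a b where 1: "b > 0" "q = of_int a / of_int b" by (rule rat_fraction)
  obtain c d where 2: "d > 0" "r = of_int c / of_int d" by (rule rat_fraction)
  let ?m = "multiplicity p"
  have q: "q = of_int (a * d) / of_int (b * d)" and r: "r = of_int (c * b) / of_int (b * d)"
    and s: "q + r = of_int (a * d + c * b) / of_int (b * d)"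
    using 1 2 by (auto simp: field_simps)
  have nz: "a * d \<noteq> 0" "c * b \<noteq> 0" "b * d \<noteq> 0" "a * d + c * b \<noteq> 0"
  proof -
    show "a * d \<noteq> 0" "c * b \<noteq> 0" "b * d \<noteq> 0" using False 1 2 by auto
    show "a * d + c * b \<noteq> 0" using False s by (metis div_0 of_int_0)
  qed
  have p: "p > 1" using assms by (rule prime_gt_1_int)
  have le: "?m (a * d) \<le> ?m (a * d + c * b) \<or> ?m (c * b) \<le> ?m (a * d + c * b)"
  proof -
    have "p ^ min (?m (a * d)) (?m (c * b)) dvd a * d + c * b"
      by (intro dvd_add multiplicity_dvd') auto
    then have "min (?m (a * d)) (?m (c * b)) \<le> ?m (a * d + c * b)"
      using nz p by (intro multiplicity_geI) auto
    then show ?thesis by linarith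
  qed
  have mono: "real_of_int p ^ k / real_of_int p ^ j \<le> real_of_int p ^ k / real_of_int p ^ i"
    if "i \<le> j" for i j k
    using that p by (intro divide_left_mono power_increasing) auto
  show ?thesis
    unfolding s unfolding q r
    unfolding padic_abs_fraction[OF assms nz(4,3)] padic_abs_fraction[OF assms nz(1,3)]
      padic_abs_fraction[OF assms nz(2,3)] le_max_iff_disj
    using le mono by blast
qed

lemma padic_abs_of_int_le: "prime p \<Longrightarrow> padic_abs p (of_int n) \<le> 1"
  using prime_gt_1_int[of p] by (simp add: padic_abs_def divide_le_eq)

lemma padic_abs_product_formula:
  assumes "prime p" "n \<noteq> 0"
  shows "1 \<le> padic_abs p (of_int n) * \<bar>real_of_int n\<bar>"
proof -
  have "p ^ multiplicity p n \<le> \<bar>n\<bar>"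
    using assms by (intro zdvd_imp_le) (auto simp: multiplicity_dvd)
  then have "real_of_int (p ^ multiplicity p n) \<le> real_of_int \<bar>n\<bar>" by (simp only: of_int_le_iff)
  then show ?thesis
    using assms prime_gt_1_int[of p] by (simp add: padic_abs_def field_simps)
qed

lemma integer_if_padic_abs_le_1:
  assumes "\<And>p. prime p \<Longrightarrow> padic_abs p q \<le> 1"
  shows "q \<in> \<int>"
proof (cases "q = 0")
  case False
  obtain a b where ab: "quotient_of q = (a, b)" by fastforce
  have b: "b > 0" and q: "q = of_int a / of_int b" and cop: "coprime a b"
    using quotient_of_denom_pos[OF ab] quotient_of_div[OF ab] quotient_of_coprime[OF ab] by auto
  have "b = 1"
  proof (rule ccontr)
    assume "b \<noteq> 1"
    then obtain p where p: "prime p" "p dvd b" using b prime_divisorE[of b] by auto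
    then have "\<not> p dvd a" using cop by (meson not_coprimeI not_prime_unit)
    then have "multiplicity p a = 0" by (rule not_dvd_imp_multiplicity_0)
    moreover have "multiplicity p b > 0" using p b
      by (subst prime_multiplicity_gt_zero_iff) auto
    ultimately have "padic_abs p q > 1"
      using prime_gt_1_int[OF p(1)] False ab by (simp add: padic_abs_def one_less_power)
    then show False using assms[OF p(1)] by simp
  qed
  then show ?thesis using q by simp
qed auto

definition real_place :: "rat \<Rightarrow> real" where
  "real_place q = \<bar>real_of_rat q\<bar>"

lemma real_place_of_int: "real_place (of_int n) = \<bar>real_of_int n\<bar>"
  unfolding real_place_def of_rat_of_int_eq ..

definition places :: "(rat \<Rightarrow> real) set" where
  "places = insert real_place (padic_abs ` {p. prime p})"

lemma real_place: "real_place \<in> places"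
  by (simp add: places_def)

lemma padic_place: "prime p \<Longrightarrow> padic_abs p \<in> places"
  by (simp add: places_def)

lemma place_cases:
  assumes "v \<in> places"
  obtains "v = real_place" | p where "prime p" "v = padic_abs p"
  using assms by (auto simp: places_def)

lemma
  assumes "v \<in> places"
  shows place_nonneg: "v q \<ge> 0"
    and place_0: "v 0 = 0"
    and place_1: "v 1 = 1"
    and place_mult: "v (q * r) = v q * v r"
    and place_eq_0_iff: "v q = 0 \<longleftrightarrow> q = 0"
proof -
  show nn: "v q \<ge> 0" for q using assms by (cases rule: place_cases) (auto simp: padic_abs_nonneg real_place_def)
  show "v 0 = 0" using assms by (cases rule: place_cases) (auto simp: padic_abs_def real_place_def)
  show 1: "v 1 = 1" using assms by (cases rule: place_cases) (auto simp: padic_abs_def real_place_def)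
  show m: "v (q * r) = v q * v r" for q r
    using assms by (cases rule: place_cases) (auto simp: padic_abs_mult real_place_def of_rat_mult abs_mult)
  show "v q = 0 \<longleftrightarrow> q = 0"
    using m[of q "inverse q"] 1 \<open>v 0 = 0\<close> by (cases "q = 0") auto
qed

lemma place_add:
  assumes "v \<in> places"
  shows "v (q + r) \<le> v q + v r"
  using assms
proof (cases rule: place_cases)
  case 1
  show ?thesis unfolding 1 real_place_def of_rat_add by (rule abs_triangle_ineq)
next
  case (2 p)
  then show ?thesis
    using padic_abs_ultrametric[of p q r] padic_abs_nonneg[of p q] padic_abs_nonneg[of p r] by auto
qed

lemma place_power: "v \<in> places \<Longrightarrow> v (q ^ n) = v q ^ n"
  by (induction n) (auto simp: place_1 place_mult)

lemma place_sum: "v \<in> places \<Longrightarrow> v (\<Sum>i\<in>A. f i) \<le> (\<Sum>i\<in>A. v (f i))"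
  by (induction A rule: infinite_finite_induct)
    (auto simp: place_0 intro: order.trans[OF place_add])

lemma place_prod: "v \<in> places \<Longrightarrow> v (\<Prod>i\<in>A. f i) = (\<Prod>i\<in>A. v (f i))"
  by (induction A rule: infinite_finite_induct) (auto simp: place_1 place_mult)

lemma place_of_int_le:
  assumes "v \<in> places"
  shows "v (of_int n) \<le> \<bar>real_of_int n\<bar>"
  using assms
proof (cases rule: place_cases)
  case (2 p)
  then show ?thesis
    using padic_abs_of_int_le[of p n] by (cases "n = 0") (auto simp: padic_abs_def)
qed (simp only: real_place_of_int order_refl)

text \<open>
  A nonzero integer that is small at one place is large in real absolute value. At a prime the
  reason is that the power of the prime dividing the integer cannot exceed it.
\<close>

lemma place_product_formula:
  assumes "v \<in> places" "n \<noteq> 0"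
  shows "1 \<le> v (of_int n) * \<bar>real_of_int n\<bar>"
  using assms(1)
proof (cases rule: place_cases)
  case 1
  have "1 \<le> \<bar>real_of_int n\<bar>" using assms(2) by linarith
  then show ?thesis unfolding 1 real_place_of_int by (metis mult_mono' mult_1 zero_le_one)
next
  case (2 p)
  then show ?thesis using padic_abs_product_formula assms by simp
qed

section \<open>Power-multiplicative seminorms\<close>

text \<open>
  Multiplicativity is required only on squares, which is how it is inherited from the spectral
  radius; the other powers follow. In contrast to full multiplicativity, these
  conditions still hold for the maximum of several absolute values.
\<close>

definition power_mult_seminorm :: "('a::field \<Rightarrow> real) \<Rightarrow> bool" where
  "power_mult_seminorm s \<longleftrightarrow> s 0 = 0 \<and> s 1 = 1 \<and> (\<forall>x. s x \<ge> 0) \<and>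
     (\<forall>x y. s (x + y) \<le> s x + s y) \<and> (\<forall>x y. s (x * y) \<le> s x * s y) \<and> (\<forall>x. s (x\<^sup>2) = (s x)\<^sup>2)"

lemma power_mult_seminormD:
  assumes "power_mult_seminorm s"
  shows "s 0 = 0" "s 1 = 1" "s x \<ge> 0" "s (x + y) \<le> s x + s y" "s (x * y) \<le> s x * s y"
    "s (x\<^sup>2) = (s x)\<^sup>2"
  using assms unfolding power_mult_seminorm_def by blast+

lemma pm_pos:
  assumes "power_mult_seminorm s" "x \<noteq> 0"
  shows "s x > 0"
proof -
  have "1 \<le> s x * s (inverse x)"
    using power_mult_seminormD(5)[OF assms(1), of x "inverse x"] power_mult_seminormD(2)[OF assms(1)] assms(2)
    by simp
  then have "s x \<noteq> 0" by auto
  then show ?thesis using power_mult_seminormD(3)[OF assms(1), of x] by linarith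
qed

lemma pm_power_le:
  assumes "power_mult_seminorm s"
  shows "s (x ^ n) \<le> s x ^ n"
proof (induction n)
  case (Suc n)
  have "s (x * x ^ n) \<le> s x * s (x ^ n)" by (rule power_mult_seminormD(5)[OF assms])
  also have "\<dots> \<le> s x * s x ^ n"
    using Suc power_mult_seminormD(3)[OF assms, of x] by (rule mult_left_mono)
  finally show ?case by simp
qed (simp add: power_mult_seminormD[OF assms])

text \<open>
  Multiplicativity on squares gives it on the powers \<open>2 ^ n\<close>, and then submultiplicativity
  of \<open>x ^ (2 ^ n) = x ^ n * x ^ (2 ^ n - n)\<close> leaves no room for a loss at the exponent \<open>n\<close>.
\<close>

lemma pm_power:
  assumes "power_mult_seminorm s"
  shows "s (x ^ n) = s x ^ n"
proof (cases "x = 0")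
  case True
  then show ?thesis by (cases n) (auto simp: power_mult_seminormD[OF assms])
next
  case False
  have two: "s (x ^ (2 ^ k)) = s x ^ (2 ^ k)" for k
  proof (induction k)
    case (Suc k)
    have "x ^ (2 ^ Suc k) = (x ^ (2 ^ k))\<^sup>2" "s x ^ (2 ^ Suc k) = (s x ^ (2 ^ k))\<^sup>2"
      by (simp_all add: mult.commute flip: power_mult)
    then show ?case using Suc power_mult_seminormD(6)[OF assms] by simp
  qed simp
  have n: "n < 2 ^ n" by (rule less_exp)
  then have split: "2 ^ n = n + (2 ^ n - n)" by simp
  have "s x ^ n * s x ^ (2 ^ n - n) = s (x ^ n * x ^ (2 ^ n - n))"
    using two[of n] split by (simp flip: power_add)
  also have "\<dots> \<le> s (x ^ n) * s (x ^ (2 ^ n - n))" by (rule power_mult_seminormD(5)[OF assms])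
  also have "\<dots> \<le> s (x ^ n) * s x ^ (2 ^ n - n)"
    by (intro mult_left_mono pm_power_le[OF assms] power_mult_seminormD(3)[OF assms])
  finally have "s x ^ n \<le> s (x ^ n)" using pm_pos[OF assms False] by simp
  then show ?thesis using pm_power_le[OF assms, of x n] by linarith
qed

lemma pm_minus:
  assumes "power_mult_seminorm s"
  shows "s (- x) = s x"
proof -
  have "(s (- 1))\<^sup>2 = 1"
    using power_mult_seminormD(6)[OF assms, of "- 1"] power_mult_seminormD(2)[OF assms] by simp
  then have 1: "s (- 1) = 1"
    using power_mult_seminormD(3)[OF assms, of "- 1"] by (simp add: power2_eq_1_iff)
  have "s (- y) \<le> s y" for y
    using power_mult_seminormD(5)[OF assms, of "- 1" y] 1 by simp
  from this[of x] this[of "- x"] show ?thesis by simp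
qed

lemma pm_diff: "power_mult_seminorm s \<Longrightarrow> s (x - y) \<le> s x + s y"
  using power_mult_seminormD(4)[of s x "- y"] pm_minus[of s y] by simp

lemma pm_sum: "power_mult_seminorm s \<Longrightarrow> s (\<Sum>i\<in>A. f i) \<le> (\<Sum>i\<in>A. s (f i))"
  by (induction A rule: infinite_finite_induct)
    (auto simp: power_mult_seminormD intro: order.trans[OF power_mult_seminormD(4)])

lemma pm_of_nat_le: "power_mult_seminorm s \<Longrightarrow> s (of_nat n) \<le> real n"
proof (induction n)
  case (Suc n)
  then show ?case
    using power_mult_seminormD(4)[OF Suc.prems, of 1 "of_nat n"] power_mult_seminormD(2)[OF Suc.prems]
    by simp
qed (simp add: power_mult_seminormD)

lemma power_growth_le:
  fixes a b C :: real
  assumes "b > 0" "\<And>k. a ^ k \<le> C * b ^ k"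
  shows "a \<le> b"
proof (rule ccontr)
  assume "\<not> a \<le> b"
  then have "a / b > 1" using assms(1) by simp
  then obtain k where "C < (a / b) ^ k" using real_arch_pow by blast
  then have "C * b ^ k < a ^ k" using assms(1) by (simp add: power_divide field_simps)
  then show False using assms(2)[of k] by simp
qed

text \<open>
  The binomial expansion of the \<open>k\<close>-th power of \<open>x + y\<close> has \<open>k + 1\<close> terms, each bounded by the
  \<open>k\<close>-th power of the maximum, and the factor \<open>k + 1\<close> disappears when \<open>k\<close>-th roots are taken.
\<close>

lemma pm_ultrametric:
  assumes pm: "power_mult_seminorm s" and nat: "\<And>n. s (of_nat n) \<le> 1"
  shows "s (x + y) \<le> max (s x) (s y)"
proof -
  note D = power_mult_seminormD[OF pm]
  define m where "m = max (s x) (s y)"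
  have le: "s x \<le> m" "s y \<le> m" by (auto simp: m_def)
  have "s (x + y) \<le> m"
  proof (cases "m = 0")
    case True
    then show ?thesis using D(4)[of x y] le by simp
  next
    case False
    then have m: "m > 0" using D(3)[of x] le by linarith
    have bound: "s (x + y) ^ k \<le> real (Suc k) * m ^ k" for k
    proof -
      have "s (x + y) ^ k = s (\<Sum>i\<le>k. of_nat (k choose i) * x ^ i * y ^ (k - i))"
        by (simp add: pm_power[OF pm, symmetric] binomial_ring)
      also have "\<dots> \<le> (\<Sum>i\<le>k. s (of_nat (k choose i) * x ^ i * y ^ (k - i)))"
        by (rule pm_sum[OF pm])
      also have "\<dots> \<le> (\<Sum>i\<le>k. m ^ k)"
      proof (rule sum_mono)
        fix i assume i: "i \<in> {..k}"
        have "s (of_nat (k choose i) * x ^ i * y ^ (k - i)) \<le>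
            s (of_nat (k choose i)) * s (x ^ i) * s (y ^ (k - i))"
          using D(5) by (meson D(3) mult_right_mono order.trans)
        also have "\<dots> \<le> 1 * m ^ i * m ^ (k - i)"
          unfolding pm_power[OF pm]
          by (intro mult_mono power_mono nat D(3) zero_le_power mult_nonneg_nonneg) (use m le in auto)
        finally show "s (of_nat (k choose i) * x ^ i * y ^ (k - i)) \<le> m ^ k"
          using i by (simp flip: power_add)
      qed
      finally show ?thesis by simp
    qed
    have "s (x + y) \<le> m * c" if c: "c > 1" for c
    proof -
      obtain B where B: "\<And>k. real (Suc k) \<le> B * c ^ k"
      proof -
        have "real (Suc k) \<le> (1 / (c - 1) + 1) * c ^ k" for k
        proof -
          have "1 + real k * (c - 1) \<le> c ^ k"
            using Bernoulli_inequality[of "c - 1" k] c by (simp add: algebra_simps)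
          then have "real k \<le> c ^ k / (c - 1)" using c by (simp add: field_simps)
          moreover have "1 \<le> c ^ k" using c by simp
          ultimately show ?thesis by (simp add: algebra_simps)
        qed
        then show ?thesis using that by blast
      qed
      have "s (x + y) ^ k \<le> B * (m * c) ^ k" for k
      proof -
        have "real (Suc k) * m ^ k \<le> (B * c ^ k) * m ^ k"
          using B[of k] m by (intro mult_right_mono) auto
        then show ?thesis using bound[of k] by (simp add: power_mult_distrib mult_ac)
      qed
      then show ?thesis by (rule power_growth_le[rotated]) (use m c in simp)
    qed
    then have "s (x + y) / m \<le> c" if "c > 1" for c
      using that unfolding pos_divide_le_eq[OF m] by (simp only: mult.commute)
    then have "s (x + y) / m \<le> 1" by (rule dense_ge)
    then show ?thesis unfolding pos_divide_le_eq[OF m] by simp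
  qed
  then show ?thesis by (simp only: m_def)
qed

section \<open>The spectral radius of a norm\<close>

text \<open>
  This is the limit of \<open>s (x ^ k)\<close> to the power \<open>1 / k\<close>, in a form that needs no proof of
  convergence and in which constant factors in the bounds for \<open>s\<close> visibly do not matter.
\<close>

definition spectral_radius :: "('a::field \<Rightarrow> real) \<Rightarrow> 'a \<Rightarrow> real" where
  "spectral_radius s x = Inf {H. 0 < H \<and> (\<exists>C. \<forall>k. s (x ^ k) \<le> C * H ^ k)}"

lemma spectral_radius_le:
  assumes "H > 0" "\<And>k. s (x ^ k) \<le> C * H ^ k"
  shows "spectral_radius s x \<le> H"
  unfolding spectral_radius_def
  by (rule cInf_lower) (use assms in \<open>auto intro: bdd_belowI[of _ 0]\<close>)

text \<open>
  The constant \<open>c\<close> allows norms given by coordinates, for which the product is merely a bounded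
  bilinear map.
\<close>

locale algebra_norm =
  fixes s :: "'a::field \<Rightarrow> real" and c :: real
  assumes nonneg: "s x \<ge> 0" and zero: "s 0 = 0" and one_pos: "s 1 > 0"
    and add: "s (x + y) \<le> s x + s y" and mult: "s (x * y) \<le> c * s x * s y"
begin

lemma c_pos: "c > 0"
proof -
  have "0 < c * s 1 * s 1" using mult[of 1 1] one_pos by simp
  then show ?thesis using one_pos by (simp add: zero_less_mult_iff)
qed

lemma nonempty: "{H. 0 < H \<and> (\<exists>C. \<forall>k. s (x ^ k) \<le> C * H ^ k)} \<noteq> {}"
proof -
  let ?H = "c * s x + 1"
  have H: "?H > 0" using c_pos nonneg[of x] by (simp add: add_nonneg_pos)
  have "s (x ^ k) \<le> s 1 * ?H ^ k" for k
  proof (induction k)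
    case (Suc k)
    have "s (x ^ Suc k) \<le> c * s x * s (x ^ k)" using mult[of x "x ^ k"] by simp
    also have "\<dots> \<le> ?H * (s 1 * ?H ^ k)"
      using Suc H c_pos nonneg by (intro mult_mono) auto
    finally show ?case by (simp add: mult_ac)
  qed simp
  then show ?thesis using H by blast
qed

lemma spectral_radius_nonneg: "spectral_radius s x \<ge> 0"
  unfolding spectral_radius_def using nonempty by (intro cInf_greatest) auto

lemma spectral_radius_less:
  assumes "spectral_radius s x < H"
  obtains C where "C \<ge> 0" "\<And>k. s (x ^ k) \<le> C * H ^ k"
proof -
  obtain H1 C where H1: "0 < H1" "H1 < H" and C: "\<And>k. s (x ^ k) \<le> C * H1 ^ k"
    using cInf_lessD[OF nonempty assms[unfolded spectral_radius_def]] by auto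
  have "C \<ge> 0" using C[of 0] nonneg[of 1] by simp
  moreover have "s (x ^ k) \<le> C * H ^ k" for k
    using C[of k] H1 \<open>C \<ge> 0\<close> by (meson less_imp_le mult_left_mono order.trans power_mono)
  ultimately show ?thesis using that by blast
qed

lemma of_nat_mult: "s (of_nat n * x) \<le> real n * s x"
proof (induction n)
  case (Suc n)
  have "s (of_nat (Suc n) * x) \<le> s x + s (of_nat n * x)"
    using add[of x "of_nat n * x"] by (simp add: algebra_simps)
  then show ?case using Suc by (simp add: algebra_simps)
qed (simp add: zero)

lemma sum: "s (\<Sum>i\<in>A. f i) \<le> (\<Sum>i\<in>A. s (f i))"
  by (induction A rule: infinite_finite_induct) (auto simp: zero intro: order.trans[OF add])

lemma spectral_radius_add: "spectral_radius s (x + y) \<le> spectral_radius s x + spectral_radius s y"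
proof (rule field_le_epsilon)
  fix e :: real assume e: "e > 0"
  let ?a = "spectral_radius s x + e / 2" and ?b = "spectral_radius s y + e / 2"
  obtain C where C: "C \<ge> 0" "\<And>k. s (x ^ k) \<le> C * ?a ^ k"
    using spectral_radius_less[of x ?a] e by auto
  obtain B where B: "B \<ge> 0" "\<And>k. s (y ^ k) \<le> B * ?b ^ k"
    using spectral_radius_less[of y ?b] e by auto
  have pos: "?a > 0" "?b > 0" using e spectral_radius_nonneg[of x] spectral_radius_nonneg[of y] by auto
  have "s ((x + y) ^ k) \<le> (c * C * B) * (?a + ?b) ^ k" for k
  proof -
    have "s ((x + y) ^ k) = s (\<Sum>i\<le>k. of_nat (k choose i) * (x ^ i * y ^ (k - i)))"
      by (simp add: binomial_ring mult.assoc)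
    also have "\<dots> \<le> (\<Sum>i\<le>k. s (of_nat (k choose i) * (x ^ i * y ^ (k - i))))" by (rule sum)
    also have "\<dots> \<le> (\<Sum>i\<le>k. real (k choose i) * (c * (C * ?a ^ i) * (B * ?b ^ (k - i))))"
    proof (rule sum_mono)
      fix i
      have "s (x ^ i * y ^ (k - i)) \<le> c * s (x ^ i) * s (y ^ (k - i))" by (rule mult)
      also have "\<dots> \<le> c * (C * ?a ^ i) * (B * ?b ^ (k - i))"
        using c_pos B C nonneg pos by (intro mult_mono mult_nonneg_nonneg) auto
      finally show "s (of_nat (k choose i) * (x ^ i * y ^ (k - i))) \<le>
          real (k choose i) * (c * (C * ?a ^ i) * (B * ?b ^ (k - i)))"
        by (meson of_nat_mult mult_left_mono of_nat_0_le_iff order.trans)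
    qed
    also have "\<dots> = (c * C * B) * (\<Sum>i\<le>k. real (k choose i) * ?a ^ i * ?b ^ (k - i))"
      by (simp add: sum_distrib_left mult_ac)
    also have "\<dots> = (c * C * B) * (?a + ?b) ^ k" by (simp only: binomial_ring)
    finally show ?thesis .
  qed
  then have "spectral_radius s (x + y) \<le> ?a + ?b" by (rule spectral_radius_le[rotated]) (use pos in simp)
  then show "spectral_radius s (x + y) \<le> spectral_radius s x + spectral_radius s y + e" by simp
qed

lemma spectral_radius_mult: "spectral_radius s (x * y) \<le> spectral_radius s x * spectral_radius s y"
proof -
  let ?a = "spectral_radius s x" and ?b = "spectral_radius s y"
  have le: "spectral_radius s (x * y) \<le> (?a + e) * (?b + e)" if e: "e > 0" for e
  proof -
    obtain C where C: "C \<ge> 0" "\<And>k. s (x ^ k) \<le> C * (?a + e) ^ k"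
      using spectral_radius_less[of x "?a + e"] e by auto
    obtain B where B: "B \<ge> 0" "\<And>k. s (y ^ k) \<le> B * (?b + e) ^ k"
      using spectral_radius_less[of y "?b + e"] e by auto
    have pos: "?a + e > 0" "?b + e > 0"
      using e spectral_radius_nonneg[of x] spectral_radius_nonneg[of y] by auto
    have "s ((x * y) ^ k) \<le> (c * C * B) * ((?a + e) * (?b + e)) ^ k" for k
    proof -
      have "s ((x * y) ^ k) \<le> c * s (x ^ k) * s (y ^ k)" using mult by (simp add: power_mult_distrib)
      also have "\<dots> \<le> c * (C * (?a + e) ^ k) * (B * (?b + e) ^ k)"
        using c_pos B C nonneg pos by (intro mult_mono mult_nonneg_nonneg) auto
      finally show ?thesis by (simp add: power_mult_distrib mult_ac)
    qed
    then show ?thesis by (rule spectral_radius_le[rotated]) (use pos in simp)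
  qed
  have "((\<lambda>e. (?a + e) * (?b + e)) \<longlongrightarrow> (?a + 0) * (?b + 0)) (at_right 0)"
    by (intro tendsto_intros)
  moreover have "\<forall>\<^sub>F e in at_right 0. spectral_radius s (x * y) \<le> (?a + e) * (?b + e)"
    using le by (auto simp: eventually_at_filter)
  ultimately show ?thesis using tendsto_lowerbound by fastforce
qed

lemma spectral_radius_square: "spectral_radius s (x\<^sup>2) = (spectral_radius s x)\<^sup>2"
proof (rule antisym)
  show "spectral_radius s (x\<^sup>2) \<le> (spectral_radius s x)\<^sup>2"
    using spectral_radius_mult[of x x] by (simp add: power2_eq_square)
  show "(spectral_radius s x)\<^sup>2 \<le> spectral_radius s (x\<^sup>2)"
  proof (rule dense_ge)
    fix H assume H: "spectral_radius s (x\<^sup>2) < H"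
    obtain C where C: "C \<ge> 0" "\<And>k. s ((x\<^sup>2) ^ k) \<le> C * H ^ k"
      using spectral_radius_less[OF H] by blast
    have Hpos: "H > 0" using H spectral_radius_nonneg[of "x\<^sup>2"] by simp
    define r where "r = sqrt H"
    have r: "r > 0" "r\<^sup>2 = H" using Hpos by (auto simp: r_def)
    let ?C = "C + c * s x * C / r"
    have "s (x ^ k) \<le> ?C * r ^ k" for k
    proof (cases "even k")
      case True
      then obtain j where j: "k = 2 * j" by blast
      have "s (x ^ k) \<le> C * r ^ k" using C(2)[of j] r by (simp add: j power_mult)
      moreover have "C * r ^ k \<le> ?C * r ^ k"
        using r C c_pos nonneg by (intro mult_right_mono) auto
      ultimately show ?thesis by simp
    next
      case False
      then obtain j where j: "k = 2 * j + 1" using oddE by blast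
      have "s (x ^ k) \<le> c * s x * s ((x\<^sup>2) ^ j)"
        using mult[of x "(x\<^sup>2) ^ j"] by (simp add: j power_mult)
      also have "\<dots> \<le> c * s x * (C * H ^ j)"
        using C c_pos nonneg by (intro mult_left_mono) auto
      also have "\<dots> = (c * s x * C / r) * r ^ k" using r by (simp add: j power_mult)
      also have "\<dots> \<le> ?C * r ^ k" using r C by (intro mult_right_mono) auto
      finally show ?thesis .
    qed
    then have "spectral_radius s x \<le> r" by (rule spectral_radius_le[rotated]) (use r in simp)
    then show "(spectral_radius s x)\<^sup>2 \<le> H" using r spectral_radius_nonneg[of x] power_mono by blast
  qed
qed

lemma power_mult_seminorm_spectral_radius: "power_mult_seminorm (spectral_radius s)"
proof -
  have "spectral_radius s 0 \<le> e" if "e > 0" for e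
  proof (rule spectral_radius_le)
    show "s (0 ^ k) \<le> s 1 * e ^ k" for k using one_pos that by (cases k) (auto simp: zero)
  qed (use that in auto)
  then have "spectral_radius s 0 \<le> 0" by (rule dense_ge)
  then have z: "spectral_radius s 0 = 0" using spectral_radius_nonneg[of 0] by simp
  have "1 \<le> H" if H: "spectral_radius s 1 < H" for H
  proof -
    obtain C where C: "\<And>k. s (1 ^ k) \<le> C * H ^ k" using spectral_radius_less[OF H] by blast
    have "1 ^ k \<le> C / s 1 * H ^ k" for k using C[of k] one_pos by (simp add: field_simps)
    then show ?thesis by (rule power_growth_le[rotated]) (use that spectral_radius_nonneg[of 1] in simp)
  qed
  then have "1 \<le> spectral_radius s 1" by (rule dense_ge)
  moreover have "spectral_radius s 1 \<le> 1" by (rule spectral_radius_le[of _ _ _ "s 1"]) auto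
  ultimately show ?thesis
    unfolding power_mult_seminorm_def
    using z spectral_radius_nonneg spectral_radius_add spectral_radius_mult spectral_radius_square
    by auto
qed

end

section \<open>Multiplicative seminorms below a given one\<close>

text \<open>
  The quotients decrease with \<open>n\<close>, so the infimum is their limit. Passing to the limit makes
  multiplication by \<open>f\<close> scale the seminorm exactly by \<open>s f\<close>; if \<open>s\<close> is a maximum of absolute
  values, the ones that survive are those that are largest at \<open>f\<close>.
\<close>

definition localization :: "('a::field \<Rightarrow> real) \<Rightarrow> 'a \<Rightarrow> 'a \<Rightarrow> real" where
  "localization s f x = (INF n. s (x * f ^ n) / s f ^ n)"

lemma localization_limit:
  assumes pm: "power_mult_seminorm s" and f: "f \<noteq> 0"
  shows "(\<lambda>n. s (x * f ^ n) / s f ^ n) \<longlonglongrightarrow> localization s f x"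
  unfolding localization_def
proof (rule LIMSEQ_decseq_INF)
  note D = power_mult_seminormD[OF pm]
  have sf: "s f > 0" by (rule pm_pos[OF pm f])
  show "bdd_below (range (\<lambda>n. s (x * f ^ n) / s f ^ n))"
    using D(3) sf by (intro bdd_belowI[of _ 0]) auto
  show "decseq (\<lambda>n. s (x * f ^ n) / s f ^ n)"
  proof (rule decseq_SucI)
    fix n
    have "s (x * f ^ Suc n) \<le> s (x * f ^ n) * s f"
      using D(5)[of "x * f ^ n" f] by (simp add: mult_ac)
    then show "s (x * f ^ Suc n) / s f ^ Suc n \<le> s (x * f ^ n) / s f ^ n"
      using sf by (simp add: field_simps)
  qed
qed

lemma localization_le:
  assumes pm: "power_mult_seminorm s" and f: "f \<noteq> 0"
  shows "localization s f x \<le> s x"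
proof -
  note D = power_mult_seminormD[OF pm]
  have "localization s f x \<le> s (x * f ^ 0) / s f ^ 0"
    unfolding localization_def
    by (rule cINF_lower)
      (use D(3) pm_pos[OF pm f] in \<open>auto intro: bdd_belowI[of _ 0]\<close>)
  then show ?thesis by simp
qed

lemma localization_mult:
  assumes pm: "power_mult_seminorm s" and f: "f \<noteq> 0"
  shows "localization s f (x * f) = localization s f x * s f"
proof -
  have sf: "s f > 0" by (rule pm_pos[OF pm f])
  have "(\<lambda>n. s (x * f ^ Suc n) / s f ^ Suc n * s f) \<longlonglongrightarrow> localization s f x * s f"
    by (intro tendsto_mult LIMSEQ_Suc[OF localization_limit[OF pm f]] tendsto_const)
  moreover have "(\<lambda>n. s (x * f ^ Suc n) / s f ^ Suc n * s f) = (\<lambda>n. s (x * f * f ^ n) / s f ^ n)"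
    using sf by (simp add: fun_eq_iff mult_ac)
  ultimately show ?thesis
    using localization_limit[OF pm f, of "x * f"] LIMSEQ_unique by metis
qed

lemma power_mult_seminorm_localization:
  assumes pm: "power_mult_seminorm s" and f: "f \<noteq> 0"
  shows "power_mult_seminorm (localization s f)"
proof -
  note D = power_mult_seminormD[OF pm]
  note lim = localization_limit[OF pm f]
  have sf: "s f > 0" by (rule pm_pos[OF pm f])
  have lim2: "(\<lambda>n. s (x * f ^ (2 * n)) / s f ^ (2 * n)) \<longlonglongrightarrow> localization s f x" for x
    using LIMSEQ_subseq_LIMSEQ[OF lim[of x], of "\<lambda>n. 2 * n"]
    by (simp add: o_def strict_mono_def)
  have nn: "localization s f x \<ge> 0" for x
    by (rule LIMSEQ_le_const[OF lim]) (use D(3) sf in auto)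
  have "localization s f 0 = 0"
    using lim[of 0] by (simp add: D(1) LIMSEQ_const_iff)
  moreover have "localization s f 1 = 1"
    using lim[of 1] sf by (simp add: pm_power[OF pm] LIMSEQ_const_iff)
  moreover have "localization s f (x + y) \<le> localization s f x + localization s f y" for x y
  proof (rule LIMSEQ_le[OF lim tendsto_add[OF lim lim]])
    have "s ((x + y) * f ^ n) / s f ^ n \<le> s (x * f ^ n) / s f ^ n + s (y * f ^ n) / s f ^ n" for n
      using D(4)[of "x * f ^ n" "y * f ^ n"] sf
      by (simp add: distrib_right divide_right_mono flip: add_divide_distrib)
    then show "\<exists>N. \<forall>n\<ge>N. s ((x + y) * f ^ n) / s f ^ n \<le> s (x * f ^ n) / s f ^ n + s (y * f ^ n) / s f ^ n"
      by blast
  qed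
  moreover have "localization s f (x * y) \<le> localization s f x * localization s f y" for x y
  proof (rule LIMSEQ_le[OF lim2 tendsto_mult[OF lim lim]])
    have "s (x * y * f ^ (2 * n)) / s f ^ (2 * n) \<le> (s (x * f ^ n) / s f ^ n) * (s (y * f ^ n) / s f ^ n)" for n
    proof -
      have "x * y * f ^ (2 * n) = (x * f ^ n) * (y * f ^ n)"
        by (simp add: mult_2 mult_2_right power_add mult_ac)
      then have "s (x * y * f ^ (2 * n)) \<le> s (x * f ^ n) * s (y * f ^ n)"
        using D(5)[of "x * f ^ n" "y * f ^ n"] by (simp only:)
      then have "s (x * y * f ^ (2 * n)) / s f ^ (2 * n) \<le> (s (x * f ^ n) * s (y * f ^ n)) / s f ^ (2 * n)"
        by (rule divide_right_mono) (use sf in simp)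
      then show ?thesis by (simp add: mult_2 power_add)
    qed
    then show "\<exists>N. \<forall>n\<ge>N. s (x * y * f ^ (2 * n)) / s f ^ (2 * n) \<le>
        (s (x * f ^ n) / s f ^ n) * (s (y * f ^ n) / s f ^ n)"
      by blast
  qed
  moreover have "localization s f (x\<^sup>2) = (localization s f x)\<^sup>2" for x
  proof -
    have "s (x\<^sup>2 * f ^ (2 * n)) / s f ^ (2 * n) = (s (x * f ^ n) / s f ^ n)\<^sup>2" for n
    proof -
      have "x\<^sup>2 * f ^ (2 * n) = (x * f ^ n)\<^sup>2" by (simp add: power_mult_distrib mult.commute flip: power_mult)
      then show ?thesis by (simp add: D(6) power_divide mult.commute flip: power_mult)
    qed
    then show ?thesis
      using lim2[of "x\<^sup>2"] tendsto_power[OF lim[of x], of 2] LIMSEQ_unique by simp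
  qed
  ultimately show ?thesis unfolding power_mult_seminorm_def using nn by simp
qed

text \<open>
  Two members of a chain may both be replaced by the smaller one, so an inequality between values
  at \<open>x\<close> and at \<open>y\<close> passes to the two separate infima.
\<close>

lemma power_mult_seminorm_INF_chain:
  assumes ne: "C \<noteq> {}" and pm: "\<And>s. s \<in> C \<Longrightarrow> power_mult_seminorm s"
    and chain: "\<And>s r. s \<in> C \<Longrightarrow> r \<in> C \<Longrightarrow> s \<le> r \<or> r \<le> s"
  shows "power_mult_seminorm (\<lambda>x. INF s\<in>C. s x)"
proof -
  let ?u = "\<lambda>x. INF s\<in>C. s x"
  have bdd: "bdd_below ((\<lambda>s. s x) ` C)" for x
    using power_mult_seminormD(3)[OF pm] by (auto intro: bdd_belowI[of _ 0])
  have lower: "?u x \<le> s x" if "s \<in> C" for s x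
    using bdd that by (intro cINF_lower) auto
  have greatest: "m \<le> ?u x" if "\<And>s. s \<in> C \<Longrightarrow> m \<le> s x" for m x
    using ne that by (intro cINF_greatest) auto
  have nn: "?u x \<ge> 0" for x using power_mult_seminormD(3)[OF pm] by (intro greatest) auto
  have const: "?u x = a" if "\<And>s. s \<in> C \<Longrightarrow> s x = a" for x a
  proof -
    have "(\<lambda>s. s x) ` C = {a}" using ne that by auto
    then show ?thesis by simp
  qed
  have below: "\<exists>q\<in>C. q x \<le> s x \<and> q y \<le> r y" if "s \<in> C" "r \<in> C" for s r x y
    using chain[OF that] that by (auto simp: le_fun_def)
  have add2: "?u (x + y) \<le> s x + r y" if sr: "s \<in> C" "r \<in> C" for s r x y
  proof -
    obtain q where q: "q \<in> C" "q x \<le> s x" "q y \<le> r y" using below[OF sr] by blast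
    have "?u (x + y) \<le> q (x + y)" by (rule lower[OF q(1)])
    also have "\<dots> \<le> q x + q y" by (rule power_mult_seminormD(4)[OF pm[OF q(1)]])
    finally show ?thesis using q by linarith
  qed
  have mult2: "?u (x * y) \<le> s x * r y" if sr: "s \<in> C" "r \<in> C" for s r x y
  proof -
    obtain q where q: "q \<in> C" "q x \<le> s x" "q y \<le> r y" using below[OF sr] by blast
    have "?u (x * y) \<le> q (x * y)" by (rule lower[OF q(1)])
    also have "\<dots> \<le> q x * q y" by (rule power_mult_seminormD(5)[OF pm[OF q(1)]])
    also have "\<dots> \<le> s x * r y"
      using q power_mult_seminormD(3)[OF pm] sr by (intro mult_mono) auto
    finally show ?thesis .
  qed
  have "?u (x + y) \<le> ?u x + ?u y" for x y
  proof -
    have "?u (x + y) - s x \<le> ?u y" if "s \<in> C" for s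
      using add2[OF that] by (intro greatest) (simp add: diff_le_eq add.commute)
    then have "?u (x + y) - ?u y \<le> ?u x" by (intro greatest) (simp add: diff_le_eq add.commute)
    then show ?thesis by simp
  qed
  moreover have mult: "?u (x * y) \<le> ?u x * ?u y" for x y
  proof (cases "x = 0")
    case True
    then show ?thesis using const[of 0 0] power_mult_seminormD(1)[OF pm] by simp
  next
    case False
    have div: "?u (x * y) / s x \<le> ?u y" if s: "s \<in> C" for s
      using mult2[OF s] pm_pos[OF pm[OF s] False]
      by (intro greatest) (simp add: pos_divide_le_eq mult.commute)
    show ?thesis
    proof (cases "?u y = 0")
      case True
      obtain s where s: "s \<in> C" using ne by blast
      have "?u (x * y) \<le> 0" using div[OF s] pm_pos[OF pm[OF s] False] True by (simp add: divide_le_0_iff)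
      then show ?thesis using True by simp
    next
      case uy: False
      then have uy: "?u y > 0" using nn[of y] by simp
      have "?u (x * y) / ?u y \<le> ?u x"
      proof (rule greatest)
        fix s assume s: "s \<in> C"
        have "?u (x * y) \<le> ?u y * s x" using div[OF s] pm_pos[OF pm[OF s] False] by (simp add: pos_divide_le_eq)
        then show "?u (x * y) / ?u y \<le> s x" using uy by (simp add: pos_divide_le_eq mult.commute)
      qed
      then show ?thesis using uy by (simp add: pos_divide_le_eq)
    qed
  qed
  moreover have "?u (x\<^sup>2) = (?u x)\<^sup>2" for x
  proof (rule antisym)
    show "?u (x\<^sup>2) \<le> (?u x)\<^sup>2" using mult[of x x] by (simp add: power2_eq_square)
    show "(?u x)\<^sup>2 \<le> ?u (x\<^sup>2)"
    proof (rule greatest)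
      fix s assume s: "s \<in> C"
      have "(?u x)\<^sup>2 \<le> (s x)\<^sup>2" by (rule power_mono[OF lower[OF s] nn])
      then show "(?u x)\<^sup>2 \<le> s (x\<^sup>2)" using power_mult_seminormD(6)[OF pm[OF s]] by simp
    qed
  qed
  ultimately show ?thesis
    unfolding power_mult_seminorm_def
    using nn const[of 0 0] const[of 1 1] power_mult_seminormD(1,2)[OF pm] by simp
qed

definition multiplicative_seminorm :: "('a::field \<Rightarrow> real) \<Rightarrow> bool" where
  "multiplicative_seminorm s \<longleftrightarrow> power_mult_seminorm s \<and> (\<forall>x y. s (x * y) = s x * s y)"

text \<open>
  A minimal power-multiplicative seminorm \<open>s\<close> agrees with all of its localizations, since these lie
  below it, and is therefore multiplicative. The minimal element is sought below the localization
  of \<open>r\<close> at \<open>t\<close>: there the value at \<open>inverse t\<close> is at most \<open>1 / r t\<close>, which forces \<open>s t = r t\<close>.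
\<close>

theorem exists_multiplicative_seminorm:
  fixes r :: "'a::field \<Rightarrow> real"
  assumes pm: "power_mult_seminorm r" and t: "t \<noteq> 0"
  obtains s where "multiplicative_seminorm s" "\<And>x. s x \<le> r x" "s t = r t"
proof -
  let ?top = "localization r t"
  define A where "A = {s. power_mult_seminorm s \<and> s \<le> ?top}"
  have top: "?top \<in> A"
    unfolding A_def using power_mult_seminorm_localization[OF pm t] by simp
  have "\<exists>m\<in>A. \<forall>a\<in>A. m \<ge> a \<longrightarrow> a = m"
  proof (rule predicate_Zorn)
    show "partial_order_on A (relation_of (\<lambda>a b. a \<ge> b) A)"
      by (rule partial_order_on_relation_ofI) auto
    fix C assume C: "C \<in> Chains (relation_of (\<lambda>a b :: 'a \<Rightarrow> real. a \<ge> b) A)"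
    have CA: "C \<subseteq> A" and chain: "\<And>s r. s \<in> C \<Longrightarrow> r \<in> C \<Longrightarrow> s \<le> r \<or> r \<le> s"
      using C unfolding Chains_def relation_of_def by auto
    show "\<exists>u\<in>A. \<forall>a\<in>C. a \<ge> u"
    proof (cases "C = {}")
      case True
      then show ?thesis using top by blast
    next
      case False
      let ?u = "\<lambda>x. INF s\<in>C. s x"
      have pmC: "\<And>s. s \<in> C \<Longrightarrow> power_mult_seminorm s" using CA A_def by blast
      have lower: "?u \<le> s" if "s \<in> C" for s
      proof (rule le_funI)
        fix x
        show "?u x \<le> s x"
          by (rule cINF_lower)
            (use that power_mult_seminormD(3)[OF pmC] in \<open>auto intro!: bdd_belowI[of _ 0]\<close>)
      qed
      obtain s where s: "s \<in> C" using False by blast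
      have "?u \<le> ?top" using lower[OF s] s CA A_def by (auto intro: order.trans)
      then have "?u \<in> A"
        using power_mult_seminorm_INF_chain[OF False pmC chain] A_def by blast
      then show ?thesis using lower by blast
    qed
  qed
  then obtain s where sA: "s \<in> A" and min: "\<And>a. a \<in> A \<Longrightarrow> a \<le> s \<Longrightarrow> a = s" by blast
  have pms: "power_mult_seminorm s" and s_le: "s \<le> ?top" using sA A_def by auto
  note D = power_mult_seminormD[OF pms]
  have mult: "s (x * y) = s x * s y" for x y
  proof (cases "y = 0")
    case True
    then show ?thesis by (simp add: D(1))
  next
    case False
    have le: "localization s y \<le> s" by (rule le_funI) (rule localization_le[OF pms False])
    have "localization s y \<in> A"
      unfolding A_def using power_mult_seminorm_localization[OF pms False] order.trans[OF le s_le]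
      by simp
    then have "localization s y = s" using le by (rule min)
    then show ?thesis using localization_mult[OF pms False, of x] by simp
  qed
  have le: "s x \<le> r x" for x
    using s_le localization_le[OF pm t, of x] by (auto simp: le_fun_def intro: order.trans)
  have rt: "r t > 0" by (rule pm_pos[OF pm t])
  have "?top (inverse t) * r t = 1"
    using localization_mult[OF pm t, of "inverse t"] t
      power_mult_seminormD(2)[OF power_mult_seminorm_localization[OF pm t]] by simp
  then have "s (inverse t) * r t \<le> 1"
    using s_le rt by (metis le_funD less_imp_le mult_right_mono)
  moreover have "s (inverse t) * s t = 1" using mult[of "inverse t" t] t D(2) by simp
  ultimately have "s (inverse t) * r t \<le> s (inverse t) * s t" by simp
  then have "r t \<le> s t" using pm_pos[OF pms, of "inverse t"] t by simp
  then have "s t = r t" using le[of t] by linarith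
  then show ?thesis
    using that[of s] pms mult le unfolding multiplicative_seminorm_def by blast
qed

section \<open>Coordinates and the norm of a number field\<close>

text \<open>
  A basis is given by coordinate functions, so that multiplication by an element becomes a
  rational matrix of fixed size \<open>d\<close>.
\<close>

locale rational_basis =
  fixes d :: nat and e :: "nat \<Rightarrow> 'a::field_char_0" and coord :: "nat \<Rightarrow> 'a \<Rightarrow> rat"
  assumes expand: "x = (\<Sum>i<d. of_rat (coord i x) * e i)"
    and coord_add: "coord i (x + y) = coord i x + coord i y"
    and coord_scale: "coord i (of_rat q * x) = q * coord i x"
    and coord_basis: "i < d \<Longrightarrow> j < d \<Longrightarrow> coord i (e j) = (if i = j then 1 else 0)"

lemma number_field_imp_rational_basis:
  assumes "number_field TYPE('a::field_char_0)"
  shows "\<exists>d e coord. rational_basis d (e :: nat \<Rightarrow> 'a) coord"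
proof -
  obtain B :: "'a set" where
    "finite_dimensional_vector_space (\<lambda>(q::rat) (x::'a). of_rat q * x) B"
    using assms unfolding number_field_def by blast
  then interpret V: finite_dimensional_vector_space "\<lambda>(q::rat) (x::'a). of_rat q * x" B .
  obtain bs where bs: "set bs = B" "distinct bs"
    using finite_distinct_list[OF V.finite_Basis] by blast
  let ?d = "length bs" and ?e = "\<lambda>i. bs ! i" and ?c = "\<lambda>i x. V.representation B x (bs ! i)"
  have span: "x \<in> V.span B" for x by (simp add: V.span_Basis)
  note ind = V.independent_Basis
  have "rational_basis ?d ?e ?c"
  proof
    fix x y :: 'a and i j :: nat and q :: rat
    have "x = (\<Sum>b\<in>B. of_rat (V.representation B x b) * b)"
      by (rule V.sum_representation_eq[symmetric, OF ind span V.finite_Basis]) simp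
    also have "\<dots> = (\<Sum>i<?d. of_rat (?c i x) * ?e i)"
      by (rule sum.reindex_bij_betw[symmetric, OF bij_betw_nth]) (use bs in auto)
    finally show "x = (\<Sum>i<?d. of_rat (?c i x) * ?e i)" .
    show "?c i (x + y) = ?c i x + ?c i y"
      using V.representation_add[OF ind span span] by simp
    show "?c i (of_rat q * x) = q * ?c i x"
      using V.representation_scale[OF ind span] by simp
    show "?c i (?e j) = (if i = j then 1 else 0)" if "i < ?d" "j < ?d"
      using V.representation_basis[OF ind, of "bs ! j"] that bs by (auto simp: nth_eq_iff_index_eq)
  qed
  then show ?thesis by blast
qed

lemma le_power_if_all_above:
  fixes a x :: real
  assumes "\<And>H. H > a \<Longrightarrow> x \<le> H ^ n"
  shows "x \<le> a ^ n"
proof -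
  have "((\<lambda>h. h ^ n) \<longlongrightarrow> a ^ n) (at_right a)" by (intro tendsto_intros)
  moreover have "\<forall>\<^sub>F h in at_right a. x \<le> h ^ n"
    using assms by (auto simp: eventually_at_filter)
  ultimately show ?thesis by (rule tendsto_lowerbound) simp
qed

lemma det_place_bound:
  assumes v: "v \<in> places" and A: "A \<in> carrier_mat n n"
    and b: "\<And>i j. i < n \<Longrightarrow> j < n \<Longrightarrow> v (A $$ (i, j)) \<le> b"
  shows "v (det A) \<le> fact n * b ^ n"
proof -
  have one: "v (- 1) = 1"
  proof -
    have "v (- 1) * v (- 1) = 1" using place_mult[OF v, of "- 1" "- 1"] place_1[OF v] by simp
    then show ?thesis using place_nonneg[OF v, of "- 1"] by (metis abs_of_nonneg real_sqrt_abs2 real_sqrt_one)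
  qed
  have "v (det A) \<le> (\<Sum>p\<in>{p. p permutes {0..<n}}. v (signof p * (\<Prod>i = 0..<n. A $$ (i, p i))))"
    unfolding det_def'[OF A] by (rule place_sum[OF v])
  also have "\<dots> \<le> (\<Sum>p\<in>{p. p permutes {0..<n}}. b ^ n)"
  proof (rule sum_mono)
    fix p assume p: "p \<in> {p. p permutes {0..<n}}"
    have "v (signof p) = 1" using one place_1[OF v] by (simp add: sign_def)
    then have "v (signof p * (\<Prod>i = 0..<n. A $$ (i, p i))) = (\<Prod>i = 0..<n. v (A $$ (i, p i)))"
      by (simp add: place_mult[OF v] place_prod[OF v])
    also have "\<dots> \<le> (\<Prod>i = 0..<n. b)"
      using p by (intro prod_mono conjI place_nonneg[OF v] b) (auto dest: permutes_in_image[of p "{0..<n}"])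
    finally show "v (signof p * (\<Prod>i = 0..<n. A $$ (i, p i))) \<le> b ^ n" by simp
  qed
  also have "\<dots> = fact n * b ^ n" by (simp add: card_permutations)
  finally show ?thesis .
qed

context rational_basis
begin

lemma coord_0 [simp]: "coord i 0 = 0"
  using coord_scale[of i 0 0] by simp

lemma coord_sum: "coord i (\<Sum>j\<in>A. f j) = (\<Sum>j\<in>A. coord i (f j))"
  by (induction A rule: infinite_finite_induct) (auto simp: coord_add)

lemma coord_minus: "coord i (- x) = - coord i x"
  using coord_scale[of i "- 1" x] by simp

lemma d_pos: "d > 0"
  using expand[of 1] by (cases d) auto

definition mult_matrix :: "'a \<Rightarrow> rat mat" where
  "mult_matrix x = mat d d (\<lambda>(i, j). coord i (x * e j))"

lemma mult_matrix_carrier [simp]: "mult_matrix x \<in> carrier_mat d d"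
  by (simp add: mult_matrix_def)

lemma coord_mult_expand: "coord i (x * y) = (\<Sum>k<d. coord i (x * e k) * coord k y)"
proof -
  have "x * y = (\<Sum>k<d. of_rat (coord k y) * (x * e k))"
    by (subst expand[of y]) (simp add: sum_distrib_left mult_ac)
  then have "coord i (x * y) = (\<Sum>k<d. coord k y * coord i (x * e k))"
    by (simp only: coord_sum coord_scale)
  then show ?thesis by (simp add: mult.commute)
qed

lemma mult_matrix_mult: "mult_matrix (x * y) = mult_matrix x * mult_matrix y"
proof (rule eq_matI)
  fix i j assume ij: "i < dim_row (mult_matrix x * mult_matrix y)"
    "j < dim_col (mult_matrix x * mult_matrix y)"
  then show "mult_matrix (x * y) $$ (i, j) = (mult_matrix x * mult_matrix y) $$ (i, j)"
    using coord_mult_expand[of i x "y * e j"]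
    by (simp add: mult_matrix_def scalar_prod_def mult.assoc lessThan_atLeast0)
qed (auto simp: mult_matrix_def)

lemma mult_matrix_1: "mult_matrix 1 = 1\<^sub>m d"
  by (rule eq_matI) (auto simp: mult_matrix_def coord_basis)

definition field_norm :: "'a \<Rightarrow> rat" where
  "field_norm x = det (mult_matrix x)"

lemma field_norm_mult: "field_norm (x * y) = field_norm x * field_norm y"
  unfolding field_norm_def mult_matrix_mult by (rule det_mult[OF mult_matrix_carrier mult_matrix_carrier])

lemma field_norm_1: "field_norm 1 = 1"
  by (simp add: field_norm_def mult_matrix_1)

lemma field_norm_power: "field_norm (x ^ n) = field_norm x ^ n"
  by (induction n) (simp_all add: field_norm_1 field_norm_mult)

lemma field_norm_nonzero: "x \<noteq> 0 \<Longrightarrow> field_norm x \<noteq> 0"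
  using field_norm_mult[of x "inverse x"] by (auto simp: field_norm_1)

definition coord_norm :: "(rat \<Rightarrow> real) \<Rightarrow> 'a \<Rightarrow> real" where
  "coord_norm v x = (\<Sum>i<d. v (coord i x))"

definition structure_const :: "(rat \<Rightarrow> real) \<Rightarrow> real" where
  "structure_const v = (\<Sum>i<d. \<Sum>j<d. coord_norm v (e i * e j))"

text \<open>
  The radius of \<open>x\<close> is the largest absolute value of \<open>x\<close> among those of the field that extend \<open>v\<close>;
  in particular \<open>radius real_place x\<close> is the largest modulus of a complex conjugate of \<open>x\<close>.
\<close>

abbreviation radius :: "(rat \<Rightarrow> real) \<Rightarrow> 'a \<Rightarrow> real" where
  "radius v \<equiv> spectral_radius (coord_norm v)"

context
  fixes v assumes v: "v \<in> places"
begin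

lemma coord_norm_nonneg: "coord_norm v x \<ge> 0"
  unfolding coord_norm_def by (intro sum_nonneg place_nonneg[OF v])

lemma coord_le_coord_norm: "i < d \<Longrightarrow> v (coord i x) \<le> coord_norm v x"
  unfolding coord_norm_def by (intro member_le_sum place_nonneg[OF v]) auto

lemma coord_norm_add: "coord_norm v (x + y) \<le> coord_norm v x + coord_norm v y"
  unfolding coord_norm_def coord_add by (simp add: sum_mono place_add[OF v] flip: sum.distrib)

lemma coord_norm_scale: "coord_norm v (of_rat q * x) = v q * coord_norm v x"
  by (simp add: coord_norm_def coord_scale place_mult[OF v] sum_distrib_left)

lemma coord_norm_0: "coord_norm v 0 = 0"
  by (simp add: coord_norm_def place_0[OF v])

lemma coord_norm_sum: "coord_norm v (\<Sum>i\<in>A. f i) \<le> (\<Sum>i\<in>A. coord_norm v (f i))"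
  by (induction A rule: infinite_finite_induct)
    (auto simp: coord_norm_0 intro: order.trans[OF coord_norm_add])

lemma coord_norm_mult: "coord_norm v (x * y) \<le> structure_const v * coord_norm v x * coord_norm v y"
proof -
  have le: "coord_norm v (e i * e j) \<le> structure_const v" if "i < d" "j < d" for i j
  proof -
    have "coord_norm v (e i * e j) \<le> (\<Sum>j<d. coord_norm v (e i * e j))"
      using that by (intro member_le_sum coord_norm_nonneg) auto
    also have "\<dots> \<le> structure_const v"
      unfolding structure_const_def
      using that by (intro member_le_sum sum_nonneg coord_norm_nonneg) auto
    finally show ?thesis .
  qed
  have "x * y = (\<Sum>i<d. \<Sum>j<d. of_rat (coord i x * coord j y) * (e i * e j))"
    by (subst expand[of x], subst expand[of y]) (simp add: sum_product of_rat_mult mult_ac)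
  then have "coord_norm v (x * y) \<le>
      (\<Sum>i<d. coord_norm v (\<Sum>j<d. of_rat (coord i x * coord j y) * (e i * e j)))"
    by (simp only: coord_norm_sum)
  also have "\<dots> \<le> (\<Sum>i<d. \<Sum>j<d. coord_norm v (of_rat (coord i x * coord j y) * (e i * e j)))"
    by (intro sum_mono coord_norm_sum)
  also have "\<dots> \<le> (\<Sum>i<d. \<Sum>j<d. v (coord i x) * v (coord j y) * structure_const v)"
    unfolding coord_norm_scale place_mult[OF v]
    by (intro sum_mono mult_left_mono le mult_nonneg_nonneg place_nonneg[OF v]) auto
  also have "\<dots> = structure_const v * coord_norm v x * coord_norm v y"
    unfolding coord_norm_def by (simp add: sum_product sum_distrib_left mult_ac)
  finally show ?thesis .
qed

lemma coord_norm_1: "coord_norm v 1 > 0"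
proof (rule ccontr)
  assume "\<not> coord_norm v 1 > 0"
  then have "v (coord i 1) = 0" if "i < d" for i
    using coord_le_coord_norm[OF that, of 1] place_nonneg[OF v, of "coord i 1"] by linarith
  then have "(\<Sum>i<d. of_rat (coord i 1) * e i) = 0"
    by (intro sum.neutral) (simp add: place_eq_0_iff[OF v])
  then show False using expand[of 1] by simp
qed

lemma algebra_norm: "algebra_norm (coord_norm v) (structure_const v)"
  by unfold_locales (use coord_norm_nonneg coord_norm_0 coord_norm_1 coord_norm_add coord_norm_mult in auto)

lemmas radius_less = algebra_norm.spectral_radius_less[OF algebra_norm]

lemma pm_radius: "power_mult_seminorm (radius v)"
  by (rule algebra_norm.power_mult_seminorm_spectral_radius[OF algebra_norm])

lemma radius_of_rat: "radius v (of_rat q) = v q"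
proof (cases "q = 0")
  case True
  then show ?thesis using power_mult_seminormD(1)[OF pm_radius] place_0[OF v] by simp
next
  case False
  have le: "radius v (of_rat r) \<le> v r" if "r \<noteq> 0" for r
  proof (rule spectral_radius_le)
    show "v r > 0" using that place_nonneg[OF v, of r] place_eq_0_iff[OF v, of r] by simp
    show "coord_norm v (of_rat r ^ k) \<le> coord_norm v 1 * v r ^ k" for k
      using coord_norm_scale[of "r ^ k" 1] by (simp add: of_rat_power place_power[OF v] mult.commute)
  qed
  have "1 \<le> radius v (of_rat q) * radius v (of_rat (inverse q))"
    using power_mult_seminormD(5)[OF pm_radius, of "of_rat q" "of_rat (inverse q)"]
      power_mult_seminormD(2)[OF pm_radius] False by (simp flip: of_rat_mult)
  also have "\<dots> \<le> radius v (of_rat q) * v (inverse q)"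
    using False by (intro mult_left_mono le power_mult_seminormD(3)[OF pm_radius]) auto
  finally have "v q * 1 \<le> v q * (radius v (of_rat q) * v (inverse q))"
    by (intro mult_left_mono place_nonneg[OF v])
  moreover have "v q * v (inverse q) = 1" using False place_1[OF v] by (simp flip: place_mult[OF v])
  ultimately have "v q \<le> radius v (of_rat q)"
    by (metis mult.left_commute mult.right_neutral)
  then show ?thesis using le[OF False] by simp
qed

definition entry_const :: real where
  "entry_const = structure_const v * (\<Sum>j<d. coord_norm v (e j))"

lemma mult_matrix_entry_le:
  assumes "i < d" "j < d"
  shows "v (mult_matrix x $$ (i, j)) \<le> entry_const * coord_norm v x"
proof -
  have "v (mult_matrix x $$ (i, j)) \<le> coord_norm v (x * e j)"
    using assms coord_le_coord_norm by (simp add: mult_matrix_def)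
  also have "\<dots> \<le> structure_const v * coord_norm v x * coord_norm v (e j)" by (rule coord_norm_mult)
  also have "\<dots> \<le> structure_const v * coord_norm v x * (\<Sum>j<d. coord_norm v (e j))"
    using assms coord_norm_nonneg
    by (intro mult_left_mono member_le_sum)
      (auto intro!: mult_nonneg_nonneg simp: structure_const_def sum_nonneg)
  finally show ?thesis by (simp add: entry_const_def mult_ac)
qed

lemma field_norm_coord_bound:
  "v (field_norm x) \<le> fact d * (entry_const * coord_norm v x) ^ d"
  unfolding field_norm_def
  by (rule det_place_bound[OF v]) (auto intro: mult_matrix_entry_le)

text \<open>
  The norm is a homogeneous polynomial of degree \<open>d\<close> in the coordinates. Applied to \<open>x ^ k\<close>, its
  constants disappear as \<open>k\<close> grows.
\<close>

lemma field_norm_le_radius: "v (field_norm x) \<le> radius v x ^ d"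
proof (rule le_power_if_all_above)
  fix H assume H: "radius v x < H"
  then have Hpos: "H > 0" using power_mult_seminormD(3)[OF pm_radius, of x] by linarith
  obtain C where C: "C \<ge> 0" "\<And>k. coord_norm v (x ^ k) \<le> C * H ^ k"
    using radius_less[OF H] by blast
  have ec: "entry_const \<ge> 0"
    unfolding entry_const_def structure_const_def
    by (intro mult_nonneg_nonneg sum_nonneg coord_norm_nonneg)
  show "v (field_norm x) \<le> H ^ d"
  proof (rule power_growth_le)
    fix k
    have "v (field_norm x) ^ k = v (field_norm (x ^ k))"
      by (simp add: field_norm_power place_power[OF v])
    also have "\<dots> \<le> fact d * (entry_const * coord_norm v (x ^ k)) ^ d"
      by (rule field_norm_coord_bound)
    also have "\<dots> \<le> fact d * (entry_const * (C * H ^ k)) ^ d"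
      using C ec coord_norm_nonneg by (intro mult_left_mono power_mono) auto
    also have "\<dots> = fact d * (entry_const * C) ^ d * (H ^ d) ^ k"
      by (simp add: power_mult_distrib mult_ac flip: power_mult)
    finally show "v (field_norm x) ^ k \<le> fact d * (entry_const * C) ^ d * (H ^ d) ^ k" .
  qed (use Hpos in simp)
qed

text \<open>
  The matrix of \<open>inverse x\<close> is the adjugate of the matrix of \<open>x\<close> divided by the norm, and the
  entries of the adjugate are determinants of size \<open>d - 1\<close>.
\<close>

lemma inverse_coord_bound:
  assumes x: "x \<noteq> 0"
  shows "v (field_norm x) * coord_norm v (inverse x) \<le>
    real d * coord_norm v 1 * (fact (d - 1) * (entry_const * coord_norm v x) ^ (d - 1))"
proof -
  let ?A = "mult_matrix x" and ?b = "fact (d - 1) * (entry_const * coord_norm v x) ^ (d - 1)"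
  have A: "?A \<in> carrier_mat d d" by simp
  note adj = adj_mat[OF A]
  have "mult_matrix (inverse x) * ?A = 1\<^sub>m d"
    using x by (simp flip: mult_matrix_mult add: mult_matrix_1)
  then have "adj_mat ?A = (mult_matrix (inverse x) * ?A) * adj_mat ?A"
    using adj(1) by simp
  also have "\<dots> = mult_matrix (inverse x) * (?A * adj_mat ?A)"
    by (rule assoc_mult_mat[OF mult_matrix_carrier A adj(1)])
  also have "\<dots> = det ?A \<cdot>\<^sub>m mult_matrix (inverse x)"
    unfolding adj(2) by (simp add: mult_smult_distrib[OF mult_matrix_carrier one_carrier_mat]
        right_mult_one_mat[OF mult_matrix_carrier])
  finally have eq: "adj_mat ?A = field_norm x \<cdot>\<^sub>m mult_matrix (inverse x)"
    by (simp add: field_norm_def)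
  have entry: "v (field_norm x * coord i (inverse x * e j)) \<le> ?b" if ij: "i < d" "j < d" for i j
  proof -
    have "field_norm x * coord i (inverse x * e j) = adj_mat ?A $$ (i, j)"
      unfolding eq using ij by (simp add: mult_matrix_def)
    also have "\<dots> = (- 1) ^ (j + i) * det (mat_delete ?A j i)"
      using ij by (simp add: adj_mat_def cofactor_def mult_matrix_def)
    finally have "v (field_norm x * coord i (inverse x * e j)) =
        v ((- 1) ^ (j + i)) * v (det (mat_delete ?A j i))"
      by (simp add: place_mult[OF v])
    also have "v ((- 1) ^ (j + i)) = 1"
      by (metis place_power[OF v] place_1[OF v] place_nonneg[OF v] place_mult[OF v] minus_one_mult_self
          power2_eq_1_iff power2_eq_square power_one neg_0_le_iff_le not_one_le_zero)
    also have "v (det (mat_delete ?A j i)) \<le> ?b"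
    proof (rule det_place_bound[OF v mat_delete_carrier[OF A]])
      show "v (mat_delete ?A j i $$ (k, l)) \<le> entry_const * coord_norm v x"
        if "k < d - 1" "l < d - 1" for k l
        using that by (auto simp: mat_delete_def mult_matrix_def[of x, THEN arg_cong[of _ _ dim_row]]
            mult_matrix_def[of x, THEN arg_cong[of _ _ dim_col]] intro!: mult_matrix_entry_le)
    qed
    finally show ?thesis by simp
  qed
  have "v (field_norm x) * v (coord i (inverse x)) \<le> ?b * coord_norm v 1" if i: "i < d" for i
  proof -
    have "field_norm x * coord i (inverse x) =
        (\<Sum>j<d. field_norm x * coord i (inverse x * e j) * coord j 1)"
      using coord_mult_expand[of i "inverse x" 1] by (simp add: sum_distrib_left mult.assoc)
    then have "v (field_norm x * coord i (inverse x)) \<le>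
        (\<Sum>j<d. v (field_norm x * coord i (inverse x * e j) * coord j 1))"
      by (simp only: place_sum[OF v])
    also have "\<dots> \<le> (\<Sum>j<d. ?b * v (coord j 1))"
      unfolding place_mult[OF v, of _ "coord _ 1"]
      using entry[OF i] by (intro sum_mono mult_right_mono place_nonneg[OF v]) auto
    finally show ?thesis by (simp add: coord_norm_def sum_distrib_left place_mult[OF v])
  qed
  then have "(\<Sum>i<d. v (field_norm x) * v (coord i (inverse x))) \<le> (\<Sum>i<d. ?b * coord_norm v 1)"
    by (intro sum_mono) auto
  then show ?thesis by (simp add: coord_norm_def[of v "inverse x"] sum_distrib_left mult_ac)
qed

lemma radius_inverse_le:
  assumes x: "x \<noteq> 0"
  shows "v (field_norm x) * radius v (inverse x) \<le> radius v x ^ (d - 1)"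
proof (rule le_power_if_all_above)
  fix H assume H: "radius v x < H"
  then have Hpos: "H > 0" using power_mult_seminormD(3)[OF pm_radius, of x] by linarith
  obtain C where C: "C \<ge> 0" "\<And>k. coord_norm v (x ^ k) \<le> C * H ^ k"
    using radius_less[OF H] by blast
  have ec: "entry_const \<ge> 0"
    unfolding entry_const_def structure_const_def
    by (intro mult_nonneg_nonneg sum_nonneg coord_norm_nonneg)
  have n: "v (field_norm x) > 0"
    using field_norm_nonzero[OF x] place_nonneg[OF v] place_eq_0_iff[OF v] by (simp add: less_le)
  let ?C = "real d * coord_norm v 1 * (fact (d - 1) * (entry_const * C) ^ (d - 1))"
  have "radius v (inverse x) \<le> H ^ (d - 1) / v (field_norm x)"
  proof (rule spectral_radius_le)
    fix k
    have "v (field_norm x) ^ k * coord_norm v (inverse x ^ k) =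
        v (field_norm (x ^ k)) * coord_norm v (inverse (x ^ k))"
      by (simp add: field_norm_power place_power[OF v] power_inverse)
    also have "\<dots> \<le> real d * coord_norm v 1 *
        (fact (d - 1) * (entry_const * coord_norm v (x ^ k)) ^ (d - 1))"
      using x by (intro inverse_coord_bound) simp
    also have "\<dots> \<le> real d * coord_norm v 1 * (fact (d - 1) * (entry_const * (C * H ^ k)) ^ (d - 1))"
      using C ec coord_norm_nonneg coord_norm_1
      by (intro mult_left_mono power_mono mult_nonneg_nonneg) auto
    also have "\<dots> = ?C * (H ^ (d - 1)) ^ k"
      by (simp add: power_mult_distrib mult_ac flip: power_mult)
    finally show "coord_norm v (inverse x ^ k) \<le> ?C * (H ^ (d - 1) / v (field_norm x)) ^ k"
      using n by (simp add: power_divide pos_le_divide_eq mult_ac)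
  qed (use Hpos n in simp)
  then show "v (field_norm x) * radius v (inverse x) \<le> H ^ (d - 1)"
    using n by (simp add: pos_le_divide_eq mult.commute)
qed

end

end

section \<open>Integrality, heights and Kronecker's theorem\<close>

context rational_basis
begin

text \<open>
  In terms of absolute values, the elements integral over the integers are those of absolute
  value at most 1 at every prime. This form makes closure under sums, products and square
  roots immediate from the properties of the radius.
\<close>

definition integral :: "'a \<Rightarrow> bool" where
  "integral x \<longleftrightarrow> (\<forall>p. prime p \<longrightarrow> radius (padic_abs p) x \<le> 1)"

lemma integralI: "(\<And>p. prime p \<Longrightarrow> radius (padic_abs p) x \<le> 1) \<Longrightarrow> integral x"
  by (simp add: integral_def)

lemma integralD: "integral x \<Longrightarrow> prime p \<Longrightarrow> radius (padic_abs p) x \<le> 1"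
  by (simp add: integral_def)

lemma integral_of_int: "integral (of_int n)"
proof (rule integralI)
  fix p :: int assume p: "prime p"
  show "radius (padic_abs p) (of_int n) \<le> 1"
    using radius_of_rat[OF padic_place[OF p], of "of_int n"] padic_abs_of_int_le[OF p, of n] by simp
qed

lemma integral_add:
  assumes "integral x" "integral y"
  shows "integral (x + y)"
proof (rule integralI)
  fix p :: int assume p: "prime p"
  let ?v = "padic_abs p"
  have "radius ?v (x + y) \<le> max (radius ?v x) (radius ?v y)"
  proof (rule pm_ultrametric[OF pm_radius[OF padic_place[OF p]]])
    show "radius ?v (of_nat n) \<le> 1" for n
      using integralD[OF integral_of_int p, of "int n"] by simp
  qed
  then show "radius ?v (x + y) \<le> 1" using integralD[OF assms(1) p] integralD[OF assms(2) p] by simp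
qed

lemma integral_mult:
  assumes "integral x" "integral y"
  shows "integral (x * y)"
proof (rule integralI)
  fix p :: int assume p: "prime p"
  let ?v = "padic_abs p"
  note pm = pm_radius[OF padic_place[OF p]]
  have "radius ?v (x * y) \<le> radius ?v x * radius ?v y" by (rule power_mult_seminormD(5)[OF pm])
  also have "\<dots> \<le> 1 * 1"
    using integralD[OF _ p] assms by (intro mult_mono power_mult_seminormD(3)[OF pm]) auto
  finally show "radius ?v (x * y) \<le> 1" by simp
qed

lemma integral_power: "integral x \<Longrightarrow> integral (x ^ n)"
  by (induction n) (use integral_of_int[of 1] integral_mult in auto)

lemma integral_diff: "integral x \<Longrightarrow> integral y \<Longrightarrow> integral (x - y)"
  using integral_add[of x "of_int (- 1) * y"] integral_mult[OF integral_of_int, of y "- 1"] by simp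

lemma integral_sum: "(\<And>i. i \<in> A \<Longrightarrow> integral (f i)) \<Longrightarrow> integral (\<Sum>i\<in>A. f i)"
  by (induction A rule: infinite_finite_induct) (use integral_of_int[of 0] integral_add in auto)

lemma integral_square_root:
  assumes "integral (x\<^sup>2)"
  shows "integral x"
proof (rule integralI)
  fix p :: int assume p: "prime p"
  let ?v = "padic_abs p"
  note pm = pm_radius[OF padic_place[OF p]]
  have "(radius ?v x)\<^sup>2 \<le> 1"
    using integralD[OF assms p] power_mult_seminormD(6)[OF pm, of x] by simp
  then show "radius ?v x \<le> 1"
    by (simp add: abs_square_le_1)
qed

lemma field_norm_integral:
  assumes "integral x"
  shows "field_norm x \<in> \<int>"
proof (rule integer_if_padic_abs_le_1)
  fix p :: int assume p: "prime p"
  note pl = padic_place[OF p]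
  have "padic_abs p (field_norm x) \<le> radius (padic_abs p) x ^ d" by (rule field_norm_le_radius[OF pl])
  also have "\<dots> \<le> 1"
    using integralD[OF assms p] power_mult_seminormD(3)[OF pm_radius[OF pl]] by (intro power_le_one)
  finally show "padic_abs p (field_norm x) \<le> 1" .
qed

lemma common_denominator:
  fixes f :: "'b \<Rightarrow> rat"
  assumes "finite A"
  shows "\<exists>a::int. a > 0 \<and> (\<forall>i\<in>A. of_int a * f i \<in> \<int>)"
  using assms
proof (induction A)
  case empty
  then show ?case by (intro exI[of _ 1]) auto
next
  case (insert i A)
  then obtain a :: int where a: "a > 0" "\<forall>i\<in>A. of_int a * f i \<in> \<int>" by blast
  obtain m n where mn: "n > 0" "f i = of_int m / of_int n" by (rule rat_fraction)
  have "of_int (a * n) * f j \<in> \<int>" if "j \<in> insert i A" for j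
  proof (cases "j = i")
    case True
    then have "of_int (a * n) * f j = of_int (a * m)" using mn by simp
    then show ?thesis by (metis Ints_of_int)
  next
    case False
    then have "of_int n * (of_int a * f j) \<in> \<int>" using that a by auto
    then show ?thesis by (simp add: mult_ac)
  qed
  then show ?case using a(1) mn(1) by (intro exI[of _ "a * n"]) auto
qed

text \<open>
  A suitable multiple of \<open>x\<close> has an integer matrix, so that its powers have coordinates with
  a bounded denominator.
\<close>

lemma exists_integral_multiple: "\<exists>a::int. a > 0 \<and> integral (of_int a * x)"
proof -
  obtain a :: int where a: "a > 0"
    and int: "\<forall>ij\<in>{..<d} \<times> {..<d}. of_int a * coord (fst ij) (x * e (snd ij)) \<in> \<int>"
    using common_denominator[of "{..<d} \<times> {..<d}" "\<lambda>ij. coord (fst ij) (x * e (snd ij))"] by auto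
  let ?u = "of_int a * x"
  have u: "coord i (?u * e j) \<in> \<int>" if "i < d" "j < d" for i j
    using int that coord_scale[of i "of_int a" "x * e j"] by (auto simp: mult.assoc)
  have pow: "coord i (?u ^ k * e j) \<in> \<int>" if "i < d" "j < d" for i j k
    using that
  proof (induction k arbitrary: j)
    case 0
    then show ?case by (simp add: coord_basis)
  next
    case (Suc k)
    have "coord i (?u ^ Suc k * e j) = coord i (?u ^ k * (?u * e j))" by (simp add: mult_ac)
    also have "\<dots> = (\<Sum>l<d. coord i (?u ^ k * e l) * coord l (?u * e j))" by (rule coord_mult_expand)
    also have "\<dots> \<in> \<int>" using Suc u by (intro Ints_sum Ints_mult) auto
    finally show ?case .
  qed
  have "integral ?u"
  proof (rule integralI)
    fix p :: int assume p: "prime p"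
    let ?v = "padic_abs p"
    note pl = padic_place[OF p]
    have "?v (coord i (?u ^ k)) \<le> coord_norm ?v 1" if i: "i < d" for i k
    proof -
      have "coord i (?u ^ k) = (\<Sum>j<d. coord i (?u ^ k * e j) * coord j 1)"
        using coord_mult_expand[of i "?u ^ k" 1] by simp
      then have "?v (coord i (?u ^ k)) \<le> (\<Sum>j<d. ?v (coord i (?u ^ k * e j)) * ?v (coord j 1))"
        by (metis (no_types, lifting) place_sum[OF pl] place_mult[OF pl] sum.cong)
      also have "\<dots> \<le> (\<Sum>j<d. 1 * ?v (coord j 1))"
      proof (intro sum_mono mult_right_mono place_nonneg[OF pl])
        fix j assume "j \<in> {..<d}"
        then have "coord i (?u ^ k * e j) \<in> \<int>" by (intro pow i) simp
        then obtain n where "coord i (?u ^ k * e j) = of_int n" by (rule Ints_cases)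
        then show "?v (coord i (?u ^ k * e j)) \<le> 1" using padic_abs_of_int_le[OF p] by simp
      qed
      finally show ?thesis by (simp add: coord_norm_def)
    qed
    then have "coord_norm ?v (?u ^ k) \<le> (\<Sum>i<d. coord_norm ?v 1)" for k
      unfolding coord_norm_def[of ?v "?u ^ k"] by (intro sum_mono) auto
    then have "coord_norm ?v (?u ^ k) \<le> real d * coord_norm ?v 1 * 1 ^ k" for k by simp
    then show "radius ?v ?u \<le> 1" by (rule spectral_radius_le[rotated]) simp
  qed
  then show ?thesis using a by blast
qed

text \<open>
  The norm of a nonzero integral element is a nonzero integer, which the product formula keeps
  away from zero. The remaining conjugates are bounded by \<open>R\<close>, so the factor \<open>s z\<close> of the norm
  cannot be too small.
\<close>

lemma liouville_inequality:
  assumes v: "v \<in> places" and s: "multiplicative_seminorm s" and le: "\<And>x. s x \<le> radius v x"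
    and z: "integral z" "z \<noteq> 0" and R: "radius real_place z \<le> R" "R \<ge> 1"
  shows "1 \<le> s z * R ^ (2 * d)"
proof -
  have pm: "power_mult_seminorm s" and mult: "\<And>x y. s (x * y) = s x * s y"
    using s by (auto simp: multiplicative_seminorm_def)
  obtain n where n: "field_norm z = of_int n" using field_norm_integral[OF z(1)] by (auto elim: Ints_cases)
  have n0: "n \<noteq> 0" using field_norm_nonzero[OF z(2)] n by auto
  have sz: "s z > 0" by (rule pm_pos[OF pm z(2)])
  have rv: "radius v z \<le> R"
    using v
  proof (cases rule: place_cases)
    case (2 p)
    then show ?thesis using integralD[OF z(1), of p] R by simp
  qed (use R in simp)
  have "v (of_int n) * s (inverse z) \<le> v (field_norm z) * radius v (inverse z)"
    unfolding n by (intro mult_left_mono le place_nonneg[OF v])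
  also have "\<dots> \<le> radius v z ^ (d - 1)" by (rule radius_inverse_le[OF v z(2)])
  also have "\<dots> \<le> R ^ (d - 1)" by (intro power_mono rv power_mult_seminormD(3)[OF pm_radius[OF v]])
  finally have "v (of_int n) * s (inverse z) * s z \<le> R ^ (d - 1) * s z"
    using sz by (intro mult_right_mono) auto
  moreover have "s (inverse z) * s z = 1"
    using mult[of "inverse z" z] z(2) power_mult_seminormD(2)[OF pm] by simp
  ultimately have 1: "v (of_int n) \<le> R ^ (d - 1) * s z" by (simp add: mult.assoc)
  have "\<bar>real_of_int n\<bar> \<le> radius real_place z ^ d"
    using field_norm_le_radius[OF real_place, of z] unfolding n real_place_of_int .
  also have "\<dots> \<le> R ^ d" by (intro power_mono R power_mult_seminormD(3)[OF pm_radius[OF real_place]])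
  finally have 2: "\<bar>real_of_int n\<bar> \<le> R ^ d" .
  have "1 \<le> v (of_int n) * \<bar>real_of_int n\<bar>" by (rule place_product_formula[OF v n0])
  also have "\<dots> \<le> (R ^ (d - 1) * s z) * R ^ d"
    using 1 2 sz R by (intro mult_mono) auto
  also have "\<dots> = s z * R ^ (d - 1 + d)" by (simp add: power_add mult_ac)
  also have "\<dots> \<le> s z * R ^ (2 * d)" using sz R by (intro mult_left_mono power_increasing) auto
  finally show ?thesis .
qed

lemma char_poly_value: "poly (char_poly (mult_matrix u)) q = field_norm (of_rat q - u)"
proof -
  have "- char_matrix (mult_matrix u) q = mult_matrix (of_rat q - u)"
  proof (rule eq_matI)
    fix i j assume "i < dim_row (mult_matrix (of_rat q - u))" "j < dim_col (mult_matrix (of_rat q - u))"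
    then have ij: "i < d" "j < d" by (auto simp: mult_matrix_def)
    have "coord i ((of_rat q - u) * e j) = coord i (of_rat q * e j + - (u * e j))"
      by (simp add: algebra_simps)
    also have "\<dots> = q * (if i = j then 1 else 0) - coord i (u * e j)"
      unfolding coord_add coord_scale coord_minus using ij by (simp add: coord_basis)
    finally show "(- char_matrix (mult_matrix u) q) $$ (i, j) = mult_matrix (of_rat q - u) $$ (i, j)"
      using ij by (simp add: char_matrix_def mult_matrix_def)
  qed (simp_all add: char_matrix_def carrier_matD[OF mult_matrix_carrier])
  then show ?thesis
    using char_poly_matrix[OF mult_matrix_carrier] by (simp add: field_norm_def)
qed

lemma char_poly_root: "poly (map_poly of_rat (char_poly (mult_matrix u))) u = 0"
proof -
  let ?M = "map_mat of_rat (transpose_mat (mult_matrix u)) :: 'a mat"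
  let ?e = "vec d e"
  have M: "?M \<in> carrier_mat d d" "transpose_mat (mult_matrix u) \<in> carrier_mat d d"
    by (simp_all add: mult_matrix_def)
  have "?M *\<^sub>v ?e = u \<cdot>\<^sub>v ?e"
  proof (rule eq_vecI)
    fix j assume "j < dim_vec (u \<cdot>\<^sub>v ?e)"
    then have j: "j < d" by simp
    have "(?M *\<^sub>v ?e) $ j = (\<Sum>i<d. of_rat (coord i (u * e j)) * e i)"
      using j by (simp add: scalar_prod_def mult_matrix_def lessThan_atLeast0)
    then show "(?M *\<^sub>v ?e) $ j = (u \<cdot>\<^sub>v ?e) $ j" using j expand[of "u * e j"] by simp
  qed (simp add: carrier_matD[OF mult_matrix_carrier])
  moreover have "?e \<noteq> 0\<^sub>v d"
  proof
    assume "?e = 0\<^sub>v d"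
    then have "e i = 0" if "i < d" for i using that by (metis index_vec index_zero_vec(1))
    then show False using expand[of 1] by simp
  qed
  ultimately have "eigenvalue ?M u"
    unfolding eigenvalue_def eigenvector_def
    using M(1) by (intro exI[of _ ?e]) (auto simp: carrier_matD[OF mult_matrix_carrier])
  then have "poly (char_poly ?M) u = 0" using eigenvalue_root_char_poly[OF M(1)] by simp
  moreover have "char_poly ?M = map_poly of_rat (char_poly (transpose_mat (mult_matrix u)))"
    by (rule of_rat_hom.char_poly_hom[OF M(2)])
  ultimately show ?thesis by (simp only: char_poly_transpose_mat[OF mult_matrix_carrier])
qed

text \<open>
  The characteristic polynomials of the powers of \<open>t\<close> take integral values of bounded size at
  \<open>0, \<dots>, d\<close>, so that only finitely many polynomials occur. The powers of \<open>t\<close> are roots of these.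
\<close>

theorem kronecker:
  assumes t: "t \<noteq> 0" and le: "\<And>v. v \<in> places \<Longrightarrow> radius v t \<le> 1"
  shows "\<exists>k>0. t ^ k = 1"
proof -
  define B where "B = (int d + 1) ^ d"
  define V :: "rat set" where "V = of_int ` {- B..B}"
  define S where "S = {p :: rat poly. degree p = d \<and> (\<forall>m\<in>{..d}. poly p (of_nat m) \<in> V)}"
  let ?vals = "\<lambda>p :: rat poly. map (\<lambda>m. poly p (of_nat m)) [0..<Suc d]"
  have "finite (?vals ` S)"
  proof (rule finite_subset)
    show "?vals ` S \<subseteq> {xs. set xs \<subseteq> V \<and> length xs = Suc d}" unfolding S_def by auto
    show "finite {xs. set xs \<subseteq> V \<and> length xs = Suc d}"
      by (rule finite_lists_length_eq) (simp add: V_def)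
  qed
  moreover have "inj_on ?vals S"
  proof (rule inj_onI)
    fix p q assume p: "p \<in> S" and q: "q \<in> S" and eq: "?vals p = ?vals q"
    show "p = q"
    proof (rule poly_eqI_degree)
      show "poly p x = poly q x" if x: "x \<in> of_nat ` {..d}" for x
      proof -
        obtain m where m: "m \<le> d" "x = of_nat m" using x by auto
        have "m \<in> set [0..<Suc d]" using m by auto
        then show ?thesis using eq m unfolding map_eq_conv by blast
      qed
      have "card (of_nat ` {..d} :: rat set) = Suc d" by (subst card_image) (auto simp: inj_on_def)
      then show "degree p < card (of_nat ` {..d} :: rat set)" "degree q < card (of_nat ` {..d} :: rat set)"
        using p q by (simp_all add: S_def)
    qed
  qed
  ultimately have finS: "finite S" by (rule finite_imageD)
  let ?T = "\<Union>p\<in>S. {x :: 'a. poly (map_poly of_rat p) x = 0}"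
  have "finite ?T"
  proof (rule finite_UN_I[OF finS])
    fix p assume "p \<in> S"
    then have "p \<noteq> 0" using d_pos by (auto simp: S_def)
    then have "map_poly of_rat p \<noteq> (0 :: 'a poly)" by (simp add: map_poly_eq_0_iff)
    then show "finite {x :: 'a. poly (map_poly of_rat p) x = 0}" by (rule poly_roots_finite)
  qed
  moreover have "t ^ k \<in> ?T" for k
  proof -
    let ?p = "char_poly (mult_matrix (t ^ k))"
    have lek: "radius v (t ^ k) \<le> 1" if v: "v \<in> places" for v
    proof -
      have "radius v (t ^ k) \<le> radius v t ^ k" by (rule pm_power_le[OF pm_radius[OF v]])
      also have "\<dots> \<le> 1" by (intro power_le_one le[OF v] power_mult_seminormD(3)[OF pm_radius[OF v]])
      finally show ?thesis .
    qed
    then have "integral (t ^ k)" by (intro integralI) (simp add: padic_place)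
    have "poly ?p (of_nat m) \<in> V" if m: "m \<le> d" for m
    proof -
      let ?z = "of_nat m - t ^ k"
      have "integral ?z" using integral_diff[OF integral_of_int[of "int m"] \<open>integral (t ^ k)\<close>] by simp
      then obtain n where n: "field_norm ?z = of_int n" using field_norm_integral by (auto elim: Ints_cases)
      have "radius real_place ?z \<le> real m + 1"
        using pm_diff[OF pm_radius[OF real_place], of "of_nat m" "t ^ k"] lek[OF real_place]
          pm_of_nat_le[OF pm_radius[OF real_place], of m] by linarith
      then have z: "radius real_place ?z \<le> real d + 1" using m by linarith
      have "\<bar>real_of_int n\<bar> \<le> radius real_place ?z ^ d"
        using field_norm_le_radius[OF real_place, of ?z] unfolding n real_place_of_int .
      also have "\<dots> \<le> (real d + 1) ^ d"
        by (intro power_mono z power_mult_seminormD(3)[OF pm_radius[OF real_place]])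
      finally have "real_of_int \<bar>n\<bar> \<le> real_of_int ((int d + 1) ^ d)" by simp
      then have "\<bar>n\<bar> \<le> (int d + 1) ^ d" by (simp only: of_int_le_iff)
      then have "of_int n \<in> V" unfolding V_def B_def by (intro imageI) (simp add: abs_le_iff minus_le_iff)
      then show ?thesis using char_poly_value[of "t ^ k" "of_nat m"] n by simp
    qed
    then have "?p \<in> S" using degree_monic_char_poly[OF mult_matrix_carrier] by (simp add: S_def)
    then show ?thesis using char_poly_root by blast
  qed
  ultimately have "finite (range (\<lambda>k. t ^ k))" by (meson finite_subset image_subsetI)
  then have "\<not> inj (\<lambda>k. t ^ k)" using finite_imageD infinite_UNIV_nat by blast
  then obtain i j where ij: "i < j" "t ^ i = t ^ j"
    unfolding inj_def by (metis nat_neq_iff)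
  have "t ^ i * t ^ (j - i) = t ^ j" using ij(1) by (simp flip: power_add)
  then have "t ^ i * t ^ (j - i) = t ^ i * 1" using ij(2) by simp
  then have "t ^ (j - i) = 1" using t by simp
  then show ?thesis using ij(1) by (intro exI[of _ "j - i"]) simp
qed

end

section \<open>Difference operators and truncated square roots\<close>

text \<open>
  In terms of the shift \<open>E\<close> on sequences this is \<open>E - r\<close>, which annihilates \<open>r ^ n\<close>. Removing
  exponential terms from \<open>Y\<close> by such operators, instead of subtracting them, changes bounds of the
  form \<open>C * g ^ n\<close> and common denominators of the form \<open>a * c ^ n\<close> only in the constants \<open>C\<close> and
  \<open>a\<close>, however many operators are applied.
\<close>

definition shift_diff :: "'a::field \<Rightarrow> (nat \<Rightarrow> 'a) \<Rightarrow> nat \<Rightarrow> 'a" where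
  "shift_diff r Y n = Y (Suc n) - r * Y n"

abbreviation shift_diffs :: "'a::field list \<Rightarrow> (nat \<Rightarrow> 'a) \<Rightarrow> nat \<Rightarrow> 'a" where
  "shift_diffs rs Y \<equiv> foldr shift_diff rs Y"

lemma shift_diffs_Cons:
  "shift_diffs (r # rs) Y n = shift_diffs rs Y (Suc n) - r * shift_diffs rs Y n"
  by (simp add: shift_diff_def)

lemma shift_diffs_add: "shift_diffs rs (\<lambda>n. Y n + Z n) n = shift_diffs rs Y n + shift_diffs rs Z n"
  by (induction rs arbitrary: n) (auto simp: shift_diff_def algebra_simps)

lemma shift_diffs_exponential_sum:
  "shift_diffs rs (\<lambda>n. \<Sum>k\<in>K. b k * \<rho> k ^ n) n = (\<Sum>k\<in>K. b k * (\<Prod>r\<leftarrow>rs. \<rho> k - r) * \<rho> k ^ n)"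
proof (induction rs arbitrary: n)
  case (Cons r rs)
  have "shift_diffs (r # rs) (\<lambda>n. \<Sum>k\<in>K. b k * \<rho> k ^ n) n =
      (\<Sum>k\<in>K. b k * (\<Prod>r\<leftarrow>rs. \<rho> k - r) * \<rho> k ^ Suc n) -
      r * (\<Sum>k\<in>K. b k * (\<Prod>r\<leftarrow>rs. \<rho> k - r) * \<rho> k ^ n)"
    by (simp add: shift_diff_def Cons del: power_Suc)
  also have "\<dots> = (\<Sum>k\<in>K. b k * (\<Prod>r\<leftarrow>rs. \<rho> k - r) * \<rho> k ^ Suc n -
      r * (b k * (\<Prod>r\<leftarrow>rs. \<rho> k - r) * \<rho> k ^ n))"
    by (simp only: sum_distrib_left sum_subtractf)
  also have "\<dots> = (\<Sum>k\<in>K. b k * (\<Prod>r\<leftarrow>(r # rs). \<rho> k - r) * \<rho> k ^ n)"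
    by (intro sum.cong refl) (simp add: algebra_simps)
  finally show ?case .
qed simp

lemma shift_diffs_kill:
  assumes "\<And>k. k \<in> K \<Longrightarrow> \<rho> k \<in> set rs"
  shows "shift_diffs rs (\<lambda>n. \<Sum>k\<in>K. b k * \<rho> k ^ n) n = 0"
proof -
  have "(\<Prod>r\<leftarrow>rs. \<rho> k - r) = 0" if "k \<in> K" for k
    using assms[OF that] by (induction rs) auto
  then show ?thesis unfolding shift_diffs_exponential_sum by (intro sum.neutral) simp
qed

text \<open>
  The solutions are found one factor at a time. The inhomogeneous equation for the factor \<open>r\<close>
  has the particular solution \<open>c q / (q - r) * q ^ n\<close> for each term \<open>c q * q ^ n\<close>.
\<close>

lemma shift_diffs_solution:
  fixes Y :: "nat \<Rightarrow> 'a::field"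
  assumes "finite Q" "Q \<inter> set rs = {}" "distinct rs" "0 \<notin> set rs"
    and "\<And>n. n \<ge> n0 \<Longrightarrow> shift_diffs rs Y n = (\<Sum>q\<in>Q. c q * q ^ n)"
  shows "\<exists>b. \<forall>n\<ge>n0. Y n = (\<Sum>q\<in>Q \<union> set rs. b q * q ^ n)"
  using assms
proof (induction rs arbitrary: Q c)
  case Nil
  then show ?case by auto
next
  case (Cons r rs)
  define Z where "Z = shift_diffs rs Y"
  define g where "g n = (\<Sum>q\<in>Q. c q / (q - r) * q ^ n)" for n
  have r: "r \<notin> Q" "r \<noteq> 0" using Cons.prems by auto
  have Z: "Z (Suc n) - r * Z n = (\<Sum>q\<in>Q. c q * q ^ n)" if "n \<ge> n0" for n
    using Cons.prems(5)[OF that] unfolding Z_def shift_diffs_Cons .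
  have g: "g (Suc n) - r * g n = (\<Sum>q\<in>Q. c q * q ^ n)" for n
  proof -
    have "g (Suc n) - r * g n = (\<Sum>q\<in>Q. c q / (q - r) * q ^ Suc n - r * (c q / (q - r) * q ^ n))"
      by (simp only: g_def sum_distrib_left sum_subtractf)
    also have "\<dots> = (\<Sum>q\<in>Q. c q * q ^ n)"
    proof (intro sum.cong refl)
      fix q assume "q \<in> Q"
      then have "q - r \<noteq> 0" using r by auto
      have "u * q ^ Suc n - r * (u * q ^ n) = u * (q - r) * q ^ n" for u
        by (simp add: algebra_simps)
      from this[of "c q / (q - r)"]
      show "c q / (q - r) * q ^ Suc n - r * (c q / (q - r) * q ^ n) = c q * q ^ n"
        using \<open>q - r \<noteq> 0\<close> by simp
    qed
    finally show ?thesis .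
  qed
  define \<beta> where "\<beta> = (Z n0 - g n0) / r ^ n0"
  have sol: "Z n = g n + \<beta> * r ^ n" if "n \<ge> n0" for n
    using that
  proof (induction n rule: dec_induct)
    case base
    then show ?case using r by (simp add: \<beta>_def)
  next
    case (step n)
    have "Z (Suc n) - g (Suc n) = r * (Z n - g n)"
      using Z[OF step(1)] g[of n] by (simp add: algebra_simps)
    then show ?case using step by (simp add: algebra_simps)
  qed
  define c' where "c' q = (if q = r then \<beta> else c q / (q - r))" for q
  have "Z n = (\<Sum>q\<in>insert r Q. c' q * q ^ n)" if n: "n \<ge> n0" for n
  proof -
    have "(\<Sum>q\<in>Q. c' q * q ^ n) = g n"
      unfolding g_def by (intro sum.cong refl) (use r in \<open>auto simp: c'_def\<close>)
    then show ?thesis using sol[OF n] r Cons.prems(1) by (simp add: c'_def)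
  qed
  then have "\<exists>b. \<forall>n\<ge>n0. Y n = (\<Sum>q\<in>insert r Q \<union> set rs. b q * q ^ n)"
    unfolding Z_def using Cons.prems by (intro Cons.IH) auto
  then show ?case by simp
qed

text \<open>
  The coefficients of the power series square root of \<open>h\<close> are found one by one: raising the
  order of approximation amounts to a linear equation for the next coefficient, in which it is
  multiplied by \<open>2 * l\<close>.
\<close>

lemma poly_square_root_mod_power:
  fixes h :: "'a::field_char_0 poly"
  assumes l: "l \<noteq> 0" and h: "poly h 0 = l\<^sup>2"
  shows "\<exists>S R. poly S 0 = l \<and> h = S\<^sup>2 + [:0, 1:] ^ Suc M * R"
proof (induction M)
  case 0
  have "poly (h - [:l:]\<^sup>2) 0 = 0" using h by simp
  then have "[:0, 1:] dvd h - [:l:]\<^sup>2" unfolding poly_eq_0_iff_dvd by simp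
  then obtain R where "h - [:l:]\<^sup>2 = [:0, 1:] * R" by (auto elim: dvdE)
  then have "h = [:l:]\<^sup>2 + [:0, 1:] ^ Suc 0 * R" by (simp add: algebra_simps)
  then show ?case by (intro exI[of _ "[:l:]"] exI[of _ R]) simp
next
  case (Suc M)
  then obtain S R where S: "poly S 0 = l" and R: "h = S\<^sup>2 + [:0, 1:] ^ Suc M * R" by blast
  define pw where "pw = ([:0, 1:] :: 'a poly) ^ Suc M"
  define a where "a = [:poly R 0 / (2 * l):]"
  have pw0: "poly pw 0 = 0" by (simp add: pw_def)
  have "poly (R - 2 * S * a - pw * a\<^sup>2) 0 = 0" using l S pw0 by (simp add: a_def)
  then have "[:0, 1:] dvd R - 2 * S * a - pw * a\<^sup>2" unfolding poly_eq_0_iff_dvd by simp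
  then obtain Q where Q: "R - 2 * S * a - pw * a\<^sup>2 = [:0, 1:] * Q" by (auto elim: dvdE)
  have "h = (S + pw * a)\<^sup>2 + pw * (R - 2 * S * a - pw * a\<^sup>2)"
    using R unfolding pw_def[symmetric] by (simp add: power2_eq_square algebra_simps)
  also have "\<dots> = (S + pw * a)\<^sup>2 + [:0, 1:] ^ Suc (Suc M) * Q"
    unfolding Q by (simp only: pw_def power_Suc mult_ac)
  finally show ?case using S pw0 by (intro exI[of _ "S + pw * a"] exI[of _ Q]) simp
qed

lemma poly_seminorm_bound:
  assumes pm: "power_mult_seminorm s" and x: "s x \<le> 1"
  shows "s (poly q x) \<le> (\<Sum>i\<le>degree q. s (coeff q i))"
proof -
  note D = power_mult_seminormD[OF pm]
  have "s (poly q x) \<le> (\<Sum>i\<le>degree q. s (coeff q i * x ^ i))"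
    unfolding poly_altdef by (rule pm_sum[OF pm])
  also have "\<dots> \<le> (\<Sum>i\<le>degree q. s (coeff q i))"
  proof (rule sum_mono)
    fix i
    have "s (coeff q i * x ^ i) \<le> s (coeff q i) * s x ^ i"
      using D(5) pm_power[OF pm] by metis
    also have "\<dots> \<le> s (coeff q i) * 1"
      using x D(3) by (intro mult_left_mono power_le_one) auto
    finally show "s (coeff q i * x ^ i) \<le> s (coeff q i)" by simp
  qed
  finally show ?thesis .
qed

lemma shift_diffs_seminorm_bound:
  assumes pm: "power_mult_seminorm s"
    and "\<And>n. n \<ge> n0 \<Longrightarrow> s (Y n) \<le> C * g ^ n"
  shows "\<exists>C. \<forall>n\<ge>n0. s (shift_diffs rs Y n) \<le> C * g ^ n"
proof (induction rs)
  case Nil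
  then show ?case using assms(2) by auto
next
  case (Cons r rs)
  then obtain C where C: "\<And>n. n \<ge> n0 \<Longrightarrow> s (shift_diffs rs Y n) \<le> C * g ^ n" by blast
  note D = power_mult_seminormD[OF pm]
  have "s (shift_diffs (r # rs) Y n) \<le> (C * g + s r * C) * g ^ n" if n: "n \<ge> n0" for n
  proof -
    have "s (shift_diffs (r # rs) Y n) \<le> s (shift_diffs rs Y (Suc n)) + s (r * shift_diffs rs Y n)"
      by (simp add: shift_diff_def pm_diff[OF pm])
    also have "\<dots> \<le> C * g ^ Suc n + s r * (C * g ^ n)"
      using C[of n] C[of "Suc n"] n D(3)[of r] D(5)[of r "shift_diffs rs Y n"]
      by (intro add_mono) (auto intro: order.trans mult_left_mono)
    finally show ?thesis by (simp add: algebra_simps)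
  qed
  then show ?case by blast
qed

section \<open>Polynomials with square values along a geometric progression\<close>

context rational_basis
begin

lemma shift_diffs_denominators:
  assumes c: "c > 0" and a: "a > 0"
    and "\<And>n. n \<ge> n0 \<Longrightarrow> integral (of_int a * of_int c ^ n * Y n)"
  shows "\<exists>a::int. a > 0 \<and> (\<forall>n\<ge>n0. integral (of_int a * of_int c ^ n * shift_diffs rs Y n))"
proof (induction rs)
  case Nil
  then show ?case using assms by auto
next
  case (Cons r rs)
  then obtain a :: int where a: "a > 0"
    and int: "\<And>n. n \<ge> n0 \<Longrightarrow> integral (of_int a * of_int c ^ n * shift_diffs rs Y n)" by blast
  obtain b :: int where b: "b > 0" "integral (of_int b * r)" using exists_integral_multiple by blast
  have "integral (of_int (a * b * c) * of_int c ^ n * shift_diffs (r # rs) Y n)" if n: "n \<ge> n0" for n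
  proof -
    have "of_int (a * b * c) * of_int c ^ n * shift_diffs (r # rs) Y n =
        of_int b * (of_int a * of_int c ^ Suc n * shift_diffs rs Y (Suc n)) -
        of_int c * ((of_int b * r) * (of_int a * of_int c ^ n * shift_diffs rs Y n))"
      unfolding shift_diffs_Cons by (simp add: algebra_simps)
    also have "integral \<dots>"
      by (intro integral_diff integral_mult[OF integral_of_int] integral_mult[OF b(2)] int)
        (use n in auto)
    finally show ?thesis .
  qed
  then show ?case using a b(1) c by (intro exI[of _ "a * b * c"]) auto
qed

text \<open>
  The denominators grow like a power of that of \<open>\<tau>\<close>, with the degree of \<open>h\<close> as exponent.
\<close>

lemma poly_powers_denominators:
  fixes h :: "'a poly"
  shows "\<exists>a c :: int. a > 0 \<and> c > 0 \<and> (\<forall>n. integral (of_int a * of_int c ^ n * poly h (\<tau> ^ n)))"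
proof -
  obtain c :: int where c: "c > 0" "integral (of_int c * \<tau>)" using exists_integral_multiple by blast
  have "\<exists>a::int. a > 0 \<and> (\<forall>i\<in>A. integral (of_int a * coeff h i))" if "finite A" for A
    using that
  proof (induction A)
    case empty
    then show ?case by (intro exI[of _ 1]) auto
  next
    case (insert i A)
    then obtain a :: int where a: "a > 0" "\<And>i. i \<in> A \<Longrightarrow> integral (of_int a * coeff h i)" by blast
    obtain b :: int where b: "b > 0" "integral (of_int b * coeff h i)"
      using exists_integral_multiple by blast
    have "integral (of_int (a * b) * coeff h j)" if "j \<in> insert i A" for j
    proof (cases "j = i")
      case True
      then show ?thesis
        using integral_mult[OF integral_of_int b(2), of a] by (simp add: mult_ac)
    next
      case False
      then show ?thesis
        using integral_mult[OF integral_of_int a(2), of j b] that by (simp add: mult_ac)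
    qed
    then show ?case using a(1) b(1) by (intro exI[of _ "a * b"]) auto
  qed
  then obtain a :: int where a: "a > 0" "\<And>i. i \<le> degree h \<Longrightarrow> integral (of_int a * coeff h i)"
    by (metis atMost_iff finite_atMost)
  let ?m = "degree h"
  have "integral (of_int a * of_int (c ^ ?m) ^ n * poly h (\<tau> ^ n))" for n
  proof -
    have "of_int a * of_int (c ^ ?m) ^ n * poly h (\<tau> ^ n) =
        (\<Sum>i\<le>?m. (of_int a * coeff h i) * ((of_int c * \<tau>) ^ (n * i) * of_int c ^ (n * (?m - i))))"
    proof -
      have "of_int a * of_int (c ^ ?m) ^ n * (coeff h i * (\<tau> ^ n) ^ i) =
          (of_int a * coeff h i) * ((of_int c * \<tau>) ^ (n * i) * of_int c ^ (n * (?m - i)))"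
        if "i \<le> ?m" for i
      proof -
        have "n * ?m = n * i + n * (?m - i)" using that by (simp flip: distrib_left)
        then have "(of_int (c ^ ?m) ^ n :: 'a) = of_int c ^ (n * i) * of_int c ^ (n * (?m - i))"
          by (simp add: mult.commute flip: power_mult power_add)
        then show ?thesis
          by (simp only: power_mult_distrib mult_ac power_mult[of \<tau> n i, symmetric])
      qed
      then show ?thesis unfolding poly_altdef sum_distrib_left by (intro sum.cong refl) auto
    qed
    also have "integral \<dots>"
      by (intro integral_sum integral_mult[OF a(2)]
          integral_mult[OF integral_power[OF c(2)] integral_power[OF integral_of_int]]) simp
    finally show ?thesis .
  qed
  then show ?thesis using a(1) c(1) by (intro exI[of _ a] exI[of _ "c ^ ?m"]) auto
qed

lemma poly_powers_radius:
  fixes h :: "'a poly"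
  shows "\<exists>A \<beta>. \<beta> \<ge> 1 \<and> (\<forall>n. radius real_place (poly h (\<tau> ^ n)) \<le> A * \<beta> ^ n)"
proof -
  let ?r = "radius real_place"
  note pm = pm_radius[OF real_place]
  note D = power_mult_seminormD[OF pm]
  let ?b = "max 1 (?r \<tau>)" and ?m = "degree h"
  have "?r (poly h (\<tau> ^ n)) \<le> (\<Sum>i\<le>?m. ?r (coeff h i)) * (?b ^ ?m) ^ n" for n
  proof -
    have "?r (poly h (\<tau> ^ n)) \<le> (\<Sum>i\<le>?m. ?r (coeff h i * (\<tau> ^ n) ^ i))"
      unfolding poly_altdef by (rule pm_sum[OF pm])
    also have "\<dots> \<le> (\<Sum>i\<le>?m. ?r (coeff h i) * (?b ^ ?m) ^ n)"
    proof (rule sum_mono)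
      fix i assume i: "i \<in> {..?m}"
      have "?r (coeff h i * (\<tau> ^ n) ^ i) \<le> ?r (coeff h i) * ?r ((\<tau> ^ n) ^ i)" by (rule D(5))
      also have "?r ((\<tau> ^ n) ^ i) = (?r \<tau> ^ i) ^ n"
        unfolding pm_power[OF pm] by (simp only: power_mult[symmetric] mult.commute)
      also have "\<dots> \<le> (?b ^ ?m) ^ n"
      proof (rule power_mono)
        have "?r \<tau> ^ i \<le> ?b ^ i" by (rule power_mono) (auto simp: D(3))
        also have "\<dots> \<le> ?b ^ ?m" using i by (intro power_increasing) auto
        finally show "?r \<tau> ^ i \<le> ?b ^ ?m" .
      qed (simp add: D(3))
      finally show "?r (coeff h i * (\<tau> ^ n) ^ i) \<le> ?r (coeff h i) * (?b ^ ?m) ^ n"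
        using D(3) by (simp add: mult_left_mono)
    qed
    finally show ?thesis by (simp add: sum_distrib_right)
  qed
  moreover have "?b ^ ?m \<ge> 1" by (rule one_le_power) simp
  ultimately show ?thesis by blast
qed

text \<open>
  Since \<open>(y - S)(y + S)\<close> is divisible by a high power of \<open>x\<close> while \<open>2 S\<close> stays away from zero,
  one of the two roots \<open>y\<close> of \<open>h x\<close> is close to \<open>S x\<close>.
\<close>

lemma square_root_approximation:
  fixes s :: "'a \<Rightarrow> real"
  assumes s: "multiplicative_seminorm s" and tau: "s \<tau> < 1" and l: "l \<noteq> 0" and S0: "poly S 0 = l"
    and h: "h = S\<^sup>2 + [:0, 1:] ^ M * R"
    and W: "\<And>n. n \<ge> 1 \<Longrightarrow> (W n)\<^sup>2 = poly h (\<tau> ^ n)"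
  shows "\<exists>n0\<ge>1. \<exists>C Y. \<forall>n\<ge>n0. (Y n)\<^sup>2 = poly h (\<tau> ^ n) \<and>
    s (Y n - poly S (\<tau> ^ n)) \<le> C * (s \<tau> ^ M) ^ n"
proof -
  have pm: "power_mult_seminorm s" and mult: "\<And>x y. s (x * y) = s x * s y"
    using s by (auto simp: multiplicative_seminorm_def)
  note D = power_mult_seminormD[OF pm]
  have st: "0 \<le> s \<tau>" "s \<tau> \<le> 1" using tau D(3)[of \<tau>] by auto
  have small: "s (\<tau> ^ n) \<le> 1" for n unfolding pm_power[OF pm] using st by (rule power_le_one)
  obtain S1 where S1: "S - [:l:] = [:0, 1:] * S1"
  proof -
    have "poly (S - [:l:]) 0 = 0" using S0 by simp
    then have "[:0, 1:] dvd S - [:l:]" unfolding poly_eq_0_iff_dvd by simp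
    then show ?thesis using that by (auto elim: dvdE)
  qed
  define K where "K = (\<Sum>i\<le>degree S1. s (coeff S1 i))"
  have "(\<lambda>n. s \<tau> ^ n * K) \<longlonglongrightarrow> 0 * K"
    by (intro tendsto_mult LIMSEQ_power_zero tendsto_const) (use st tau in simp)
  moreover have sl: "s l > 0" by (rule pm_pos[OF pm l])
  ultimately have "\<forall>\<^sub>F n in sequentially. s \<tau> ^ n * K < s l / 2"
    by (intro order_tendstoD(2)) auto
  then obtain n1 where n1: "\<And>n. n \<ge> n1 \<Longrightarrow> s \<tau> ^ n * K < s l / 2"
    by (auto simp: eventually_sequentially)
  define c where "c = s 2 * (s l / 2) / 2"
  have c: "c > 0" unfolding c_def using sl pm_pos[OF pm, of 2] by simp
  define CR where "CR = (\<Sum>i\<le>degree R. s (coeff R i))"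
  have "\<exists>y. y\<^sup>2 = poly h (\<tau> ^ n) \<and> s (y - poly S (\<tau> ^ n)) \<le> CR / c * (s \<tau> ^ M) ^ n"
    if n: "n \<ge> max 1 n1" for n
  proof -
    let ?x = "\<tau> ^ n" and ?w = "W n"
    let ?q = "poly S ?x"
    have "?q = l + ?x * poly S1 ?x"
    proof -
      have "poly (S - [:l:]) ?x = ?x * poly S1 ?x" unfolding S1 by simp
      then show ?thesis by (simp add: algebra_simps)
    qed
    then have "s l \<le> s ?q + s (?x * poly S1 ?x)"
      using pm_diff[OF pm, of ?q "?x * poly S1 ?x"] by simp
    also have "s (?x * poly S1 ?x) \<le> s \<tau> ^ n * K"
      unfolding mult pm_power[OF pm] K_def
      using poly_seminorm_bound[OF pm small] st by (intro mult_left_mono) auto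
    finally have q: "s ?q \<ge> s l / 2" using n1[of n] n by simp
    have "(?w + ?q) - (?w - ?q) = 2 * ?q" by simp
    then have "s 2 * s ?q \<le> s (?w + ?q) + s (?w - ?q)"
      using pm_diff[OF pm, of "?w + ?q" "?w - ?q"] mult by simp
    moreover have "s 2 * (s l / 2) \<le> s 2 * s ?q" using q D(3) by (rule mult_left_mono)
    ultimately have or: "s (?w + ?q) \<ge> c \<or> s (?w - ?q) \<ge> c" unfolding c_def by linarith
    have "?w\<^sup>2 = ?q\<^sup>2 + ?x ^ M * poly R ?x" using W[of n] n unfolding h by simp
    then have "(?w - ?q) * (?w + ?q) = ?x ^ M * poly R ?x"
      by (simp add: power2_eq_square algebra_simps)
    then have "s (?w - ?q) * s (?w + ?q) = (s \<tau> ^ M) ^ n * s (poly R ?x)"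
      by (simp add: mult[symmetric] pm_power[OF pm, symmetric] mult.commute flip: power_mult)
    also have "\<dots> \<le> (s \<tau> ^ M) ^ n * CR"
      unfolding CR_def using poly_seminorm_bound[OF pm small] st by (intro mult_left_mono) auto
    finally have prod: "s (?w - ?q) * s (?w + ?q) \<le> CR * (s \<tau> ^ M) ^ n" by (simp add: mult.commute)
    have quot: "a \<le> CR / c * (s \<tau> ^ M) ^ n" if "a * b \<le> CR * (s \<tau> ^ M) ^ n" "b \<ge> c" "a \<ge> 0" for a b
    proof -
      have "a * c \<le> a * b" using that by (intro mult_left_mono) auto
      then have "a * c \<le> CR * (s \<tau> ^ M) ^ n" using that by linarith
      then show ?thesis using c by (simp add: pos_le_divide_eq)
    qed
    show ?thesis
    proof (cases "s (?w + ?q) \<ge> c")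
      case True
      then show ?thesis using quot[OF prod] D(3) W[of n] n by (intro exI[of _ ?w]) auto
    next
      case False
      then have "s (?w - ?q) \<ge> c" using or by blast
      then have "s (?w + ?q) \<le> CR / c * (s \<tau> ^ M) ^ n"
        using quot[of "s (?w + ?q)" "s (?w - ?q)"] prod D(3) by (simp add: mult.commute)
      moreover have "s (- ?w - ?q) = s (?w + ?q)" using pm_minus[OF pm, of "?w + ?q"] by simp
      ultimately show ?thesis using W[of n] n by (intro exI[of _ "- ?w"]) auto
    qed
  qed
  then obtain Y where Y: "(Y n)\<^sup>2 = poly h (\<tau> ^ n)"
      "s (Y n - poly S (\<tau> ^ n)) \<le> CR / c * (s \<tau> ^ M) ^ n" if "n \<ge> max 1 n1" for n
    by metis
  show ?thesis
  proof (intro exI conjI allI impI)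
    show "max 1 n1 \<ge> 1" by simp
  qed (use Y in blast)+
qed

text \<open>
  At the chosen absolute value, a suitable choice \<open>Y n\<close> of square roots is close to a combination of
  the sequences \<open>(\<tau> ^ k) ^ n\<close>, and difference operators remove these up to a prescribed order. What
  remains decays as fast as desired, whereas its denominators and its conjugates grow at a rate
  that does not depend on the order. By Liouville's inequality it is eventually zero. So \<open>Y\<close>
  satisfies a linear recurrence and is eventually a polynomial in \<open>\<tau> ^ n\<close>, whose square has
  infinitely many values in common with \<open>h\<close>.
\<close>

theorem square_values_imp_square:
  fixes h :: "'a poly"
  assumes v: "v \<in> places" and s: "multiplicative_seminorm s" and le: "\<And>x. s x \<le> radius v x"
    and tau: "\<tau> \<noteq> 0" "s \<tau> < 1" and l: "l \<noteq> 0" and h0: "poly h 0 = l\<^sup>2"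
    and W: "\<And>n. n \<ge> 1 \<Longrightarrow> (W n)\<^sup>2 = poly h (\<tau> ^ n)"
  shows "\<exists>P. h = P\<^sup>2"
proof -
  have pm: "power_mult_seminorm s" and mult: "\<And>x y. s (x * y) = s x * s y"
    using s by (auto simp: multiplicative_seminorm_def)
  note D = power_mult_seminormD[OF pm]
  let ?r = "radius real_place"
  note pmr = pm_radius[OF real_place]
  note Dr = power_mult_seminormD[OF pmr]
  have st: "s \<tau> > 0" by (rule pm_pos[OF pm tau(1)])
  have distinct_powers: "i = j" if "\<tau> ^ i = \<tau> ^ j" for i j
  proof -
    have eq: "s \<tau> ^ i = s \<tau> ^ j" using that by (metis pm_power[OF pm])
    have "\<not> i < j" "\<not> j < i"
      using eq power_strict_decreasing[of i j "s \<tau>"] power_strict_decreasing[of j i "s \<tau>"] st tau(2)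
      by auto
    then show ?thesis by simp
  qed
  obtain a0 c :: int where ac: "a0 > 0" "c > 0"
    and int_h: "\<And>n. integral (of_int a0 * of_int c ^ n * poly h (\<tau> ^ n))"
    using poly_powers_denominators[of h \<tau>] by blast
  obtain A0 \<beta> where \<beta>: "\<beta> \<ge> 1" and arch_h: "\<And>n. ?r (poly h (\<tau> ^ n)) \<le> A0 * \<beta> ^ n"
    using poly_powers_radius[of h \<tau>] by blast
  define B where "B = real_of_int c * \<beta>"
  have B: "B \<ge> 1" unfolding B_def using ac(2) \<beta> mult_mono[of 1 "real_of_int c" 1 \<beta>] by simp
  \<comment> \<open>The bounds \<open>c\<close> and \<open>B\<close> do not involve the order of approximation, so \<open>M\<close> can be chosen
      after them.\<close>
  obtain M where M: "real_of_int c * B ^ (2 * d) * s \<tau> ^ Suc M < 1"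
  proof -
    have pos: "real_of_int c * B ^ (2 * d) > 0" using ac(2) B by simp
    then obtain M where "s \<tau> ^ M < 1 / (real_of_int c * B ^ (2 * d))"
      using real_arch_pow_inv[OF _ tau(2)] by (metis zero_less_divide_1_iff)
    moreover have "s \<tau> ^ Suc M \<le> s \<tau> ^ M" using st tau(2) by (intro power_decreasing) auto
    ultimately have "s \<tau> ^ Suc M < 1 / (real_of_int c * B ^ (2 * d))" by linarith
    then show ?thesis using that[of M] pos by (simp add: pos_less_divide_eq mult.commute)
  qed
  define \<gamma> where "\<gamma> = s \<tau> ^ Suc M"
  have \<gamma>: "\<gamma> > 0" using st by (simp add: \<gamma>_def)
  obtain S R where S0: "poly S 0 = l" and hS: "h = S\<^sup>2 + [:0, 1:] ^ Suc M * R"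
    using poly_square_root_mod_power[OF l h0] by blast
  obtain n0 C Y where n0: "n0 \<ge> 1" and Y2: "\<And>n. n \<ge> n0 \<Longrightarrow> (Y n)\<^sup>2 = poly h (\<tau> ^ n)"
    and Y_S: "\<And>n. n \<ge> n0 \<Longrightarrow> s (Y n - poly S (\<tau> ^ n)) \<le> C * \<gamma> ^ n"
    using square_root_approximation[OF s tau(2) l S0 hS W] unfolding \<gamma>_def by blast
  define rs where "rs = map (\<lambda>k. \<tau> ^ k) [0..<Suc (degree S)]"
  have rs: "distinct rs" "0 \<notin> set rs"
    unfolding rs_def using distinct_powers tau(1) by (auto simp: distinct_map inj_on_def simp del: upt_Suc)
  define Z where "Z = shift_diffs rs Y"

  \<comment> \<open>The operators annihilate \<open>S\<close>, so \<open>Z\<close> inherits the smallness of \<open>Y - S\<close>.\<close>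
  have Z_eq: "Z n = shift_diffs rs (\<lambda>n. Y n - poly S (\<tau> ^ n)) n" for n
  proof -
    have "poly S (\<tau> ^ n) = (\<Sum>k\<le>degree S. coeff S k * (\<tau> ^ k) ^ n)" for n
      unfolding poly_altdef by (simp add: mult.commute flip: power_mult)
    then have "shift_diffs rs (\<lambda>n. poly S (\<tau> ^ n)) n = 0"
      using shift_diffs_kill[of "{..degree S}" "\<lambda>k. \<tau> ^ k" rs "coeff S" n]
      by (auto simp: rs_def simp del: upt_Suc)
    then show ?thesis
      using shift_diffs_add[of rs "\<lambda>n. Y n - poly S (\<tau> ^ n)" "\<lambda>n. poly S (\<tau> ^ n)" n]
      by (simp add: Z_def)
  qed
  obtain C1 where C1: "\<And>n. n \<ge> n0 \<Longrightarrow> s (Z n) \<le> C1 * \<gamma> ^ n"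
    unfolding Z_eq using shift_diffs_seminorm_bound[OF pm Y_S] by blast
  have Y_arch: "?r (Y n) \<le> max A0 1 * \<beta> ^ n" if n: "n \<ge> n0" for n
  proof (rule power2_le_imp_le)
    have b: "1 \<le> max A0 1 * \<beta> ^ n" using \<beta> one_le_power[of \<beta> n] mult_mono[of 1 "max A0 1" 1 "\<beta> ^ n"] by simp
    have "(?r (Y n))\<^sup>2 \<le> A0 * \<beta> ^ n" using arch_h[of n] Y2[OF n] Dr(6)[of "Y n"] by simp
    also have "\<dots> \<le> max A0 1 * \<beta> ^ n" using \<beta> by (intro mult_right_mono) auto
    also have "\<dots> \<le> (max A0 1 * \<beta> ^ n)\<^sup>2" by (rule self_le_power[OF b]) simp
    finally show "(?r (Y n))\<^sup>2 \<le> (max A0 1 * \<beta> ^ n)\<^sup>2" .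
    show "0 \<le> max A0 1 * \<beta> ^ n" using b by linarith
  qed
  then obtain A1 where A1: "\<And>n. n \<ge> n0 \<Longrightarrow> ?r (Z n) \<le> A1 * \<beta> ^ n"
    unfolding Z_def using shift_diffs_seminorm_bound[OF pmr Y_arch] by blast
  have "integral (of_int a0 * of_int c ^ n * Y n)" if n: "n \<ge> n0" for n
  proof (rule integral_square_root)
    have "(of_int a0 * of_int c ^ n * Y n)\<^sup>2 =
        of_int (a0 * c ^ n) * (of_int a0 * of_int c ^ n * poly h (\<tau> ^ n))"
      by (simp add: power2_eq_square flip: Y2[OF n])
    then show "integral ((of_int a0 * of_int c ^ n * Y n)\<^sup>2)"
      by (simp only: integral_mult[OF integral_of_int int_h])
  qed
  then obtain a :: int where a: "a > 0"
    and int_Z: "\<And>n. n \<ge> n0 \<Longrightarrow> integral (of_int a * of_int c ^ n * Z n)"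
    unfolding Z_def using shift_diffs_denominators[OF ac(2,1)] by blast

  define K where "K = real_of_int a * max A1 1"
  have K: "K \<ge> 1" unfolding K_def using a mult_mono[of 1 "real_of_int a" 1 "max A1 1"] by simp
  define \<theta> where "\<theta> = real_of_int c * B ^ (2 * d) * \<gamma>"
  have \<theta>: "\<theta> \<ge> 0" "\<theta> < 1" using M ac(2) B \<gamma> by (auto simp: \<theta>_def \<gamma>_def)
  have s_int: "s (of_int k) \<le> real_of_int k" if "k > 0" for k
  proof -
    have "s (of_int k) \<le> radius v (of_rat (of_int k))" using le[of "of_int k"] by simp
    also have "\<dots> = v (of_int k)" by (rule radius_of_rat[OF v])
    also have "\<dots> \<le> \<bar>real_of_int k\<bar>" by (rule place_of_int_le[OF v])
    finally show ?thesis using that by simp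
  qed
  have r_int: "?r (of_int k) = real_of_int k" if "k > 0" for k
    using radius_of_rat[OF real_place, of "of_int k"] that by (simp add: real_place_of_int)
  have key: "1 \<le> real_of_int a * C1 * K ^ (2 * d) * \<theta> ^ n" if n: "n \<ge> n0" and nz: "Z n \<noteq> 0" for n
  proof -
    let ?z = "of_int a * of_int c ^ n * Z n"
    have "?r ?z \<le> ?r (of_int a * of_int c ^ n) * ?r (Z n)" by (rule Dr(5))
    also have "\<dots> \<le> (real_of_int a * real_of_int c ^ n) * (A1 * \<beta> ^ n)"
      using A1[OF n] Dr(3) r_int[of "a * c ^ n"] a ac(2) by (intro mult_mono) auto
    also have "\<dots> = real_of_int a * A1 * B ^ n" by (simp add: B_def power_mult_distrib mult_ac)
    also have "\<dots> \<le> K * B ^ n" unfolding K_def using a B by (intro mult_right_mono mult_left_mono) auto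
    finally have r: "?r ?z \<le> K * B ^ n" .
    have R1: "K * B ^ n \<ge> 1" using K B one_le_power[OF B, of n] mult_mono[of 1 K 1 "B ^ n"] by simp
    have "s ?z \<le> (real_of_int a * real_of_int c ^ n) * (C1 * \<gamma> ^ n)"
      unfolding mult using C1[OF n] s_int[OF a] s_int[OF ac(2)] D(3) a ac(2)
      unfolding pm_power[OF pm] by (intro mult_mono power_mono mult_nonneg_nonneg) auto
    moreover have "1 \<le> s ?z * (K * B ^ n) ^ (2 * d)"
      using a ac(2) nz by (intro liouville_inequality[OF v s le int_Z[OF n] _ r R1]) auto
    ultimately have "1 \<le> ((real_of_int a * real_of_int c ^ n) * (C1 * \<gamma> ^ n)) * (K * B ^ n) ^ (2 * d)"
      using R1 by (meson mult_right_mono order.trans zero_le_power zero_le_one)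
    also have "\<dots> = real_of_int a * C1 * K ^ (2 * d) * \<theta> ^ n"
      by (simp add: \<theta>_def power_mult_distrib mult_ac flip: power_mult)
    finally show ?thesis .
  qed
  have "(\<lambda>n. real_of_int a * C1 * K ^ (2 * d) * \<theta> ^ n) \<longlonglongrightarrow> real_of_int a * C1 * K ^ (2 * d) * 0"
    using \<theta> by (intro tendsto_mult LIMSEQ_power_zero tendsto_const) auto
  then have "\<forall>\<^sub>F n in sequentially. real_of_int a * C1 * K ^ (2 * d) * \<theta> ^ n < 1"
    by (intro order_tendstoD(2)) auto
  then obtain n2 where n2: "\<And>n. n \<ge> n2 \<Longrightarrow> real_of_int a * C1 * K ^ (2 * d) * \<theta> ^ n < 1"
    by (auto simp: eventually_sequentially)
  let ?N = "max n0 n2"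
  have "Z n = 0" if "n \<ge> ?N" for n using key[of n] n2[of n] that by fastforce
  then have "\<exists>b. \<forall>n\<ge>?N. Y n = (\<Sum>q\<in>{} \<union> set rs. b q * q ^ n)"
    using rs by (intro shift_diffs_solution) (auto simp: Z_def)
  then obtain b where b: "\<And>n. n \<ge> ?N \<Longrightarrow> Y n = (\<Sum>q\<in>set rs. b q * q ^ n)" by auto
  define P where "P = (\<Sum>k\<le>degree S. monom (b (\<tau> ^ k)) k)"
  have YP: "Y n = poly P (\<tau> ^ n)" if "n \<ge> ?N" for n
  proof -
    have "set rs = (\<lambda>k. \<tau> ^ k) ` {..degree S}" by (auto simp: rs_def simp del: upt_Suc)
    then have "Y n = (\<Sum>k\<le>degree S. b (\<tau> ^ k) * (\<tau> ^ k) ^ n)"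
      using b[OF that] distinct_powers by (simp add: sum.reindex inj_on_def)
    then show ?thesis by (simp add: P_def poly_sum poly_monom mult.commute flip: power_mult)
  qed
  have "infinite ((\<lambda>n. \<tau> ^ n) ` {?N..})"
    using distinct_powers by (subst finite_image_iff) (auto simp: inj_on_def infinite_Ici)
  moreover have "(\<lambda>n. \<tau> ^ n) ` {?N..} \<subseteq> {x. poly (h - P\<^sup>2) x = 0}"
  proof safe
    fix n assume n: "n \<ge> ?N"
    show "poly (h - P\<^sup>2) (\<tau> ^ n) = 0" using Y2[of n] YP[OF n] n by simp
  qed
  ultimately have "h - P\<^sup>2 = 0" using poly_roots_finite finite_subset by blast
  then show ?thesis by (intro exI[of _ P]) simp
qed

end

section \<open>Geometric progressions on hyperelliptic curves\<close>

text \<open>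
  At a root \<open>x\<close> of \<open>q\<close> the square \<open>q X * q (t X)\<close> vanishes together with its derivative
  \<open>q' x * q (t x)\<close>, so \<open>t x\<close> is a root as well. Iterating, the finitely many roots would contain
  all \<open>t ^ n x\<close>.
\<close>

lemma product_with_dilation_square_imp_root_of_unity:
  fixes q :: "'a::alg_closed_field poly"
  assumes deg: "degree q > 0" and q0: "poly q 0 \<noteq> 0"
    and simple: "\<And>x. poly q x = 0 \<Longrightarrow> poly (pderiv q) x \<noteq> 0"
    and sq: "q * pcompose q [:0, t:] = T\<^sup>2" and t: "t \<noteq> 0"
  shows "\<exists>k>0. t ^ k = 1"
proof -
  have step: "poly q (t * x) = 0" if x: "poly q x = 0" for x
  proof -
    have "(poly T x)\<^sup>2 = poly (q * pcompose q [:0, t:]) x" unfolding sq by simp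
    then have T: "poly T x = 0" using x by simp
    have "pderiv (q * pcompose q [:0, t:]) = pderiv (T * T)" unfolding sq power2_eq_square ..
    then have "poly (pderiv (q * pcompose q [:0, t:])) x = poly (pderiv (T * T)) x" by simp
    then have "poly (pderiv q) x * poly q (t * x) = 0"
      using x T by (simp add: pderiv_mult poly_pcompose mult.commute)
    then show ?thesis using simple[OF x] by simp
  qed
  obtain x where x: "poly q x = 0" using alg_closed_imp_poly_has_root[OF deg] by blast
  have roots: "poly q (t ^ n * x) = 0" for n
    by (induction n) (use x step in \<open>auto simp: mult.assoc\<close>)
  have "finite {x. poly q x = 0}" using deg by (intro poly_roots_finite) auto
  then have "finite (range (\<lambda>n. t ^ n * x))" by (rule finite_subset[rotated]) (use roots in auto)
  then have "\<not> inj (\<lambda>n. t ^ n * x)" using finite_imageD infinite_UNIV_nat by blast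
  then obtain i j where ij: "i < j" "t ^ i * x = t ^ j * x" unfolding inj_def by (metis nat_neq_iff)
  have "x \<noteq> 0" using x q0 by auto
  then have "t ^ i = t ^ j" using ij(2) by simp
  moreover have "t ^ i * t ^ (j - i) = t ^ j" using ij(1) by (simp flip: power_add)
  ultimately have "t ^ i * t ^ (j - i) = t ^ i * 1" by simp
  then have "t ^ (j - i) = 1" using t by simp
  then show ?thesis using ij(1) by (intro exI[of _ "j - i"]) simp
qed

lemma to_ac_comm_ring_hom: "comm_ring_hom (to_ac :: 'a::field \<Rightarrow> 'a alg_closure)"
  by unfold_locales auto

theorem theorem2p2:
  fixes f :: "'a::field_char_0 poly" and N :: enat and P :: "nat \<Rightarrow> 'a \<times> 'a"
  assumes "number_field TYPE('a)"
    and "hyperelliptic f"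
    and "geometric_progression_seq f N P"
    and "inj_on P (seq_indices N)"
  shows "N < \<infinity>"
proof (rule ccontr)
  assume "\<not> N < \<infinity>"
  then have idx: "i \<in> seq_indices N \<longleftrightarrow> i \<ge> 1" for i by (simp add: seq_indices_def)
  obtain p t where p: "p \<noteq> 0" and t: "t \<noteq> 0" and x: "\<And>i. i \<ge> 1 \<Longrightarrow> fst (P i) = p * t ^ i"
  proof -
    have "\<exists>p t. p \<noteq> 0 \<and> t \<noteq> 0 \<and> (\<forall>i\<ge>1. fst (P i) = p * t ^ i)"
      using assms(3) unfolding geometric_progression_seq_def Ball_def idx by (elim conjE)
    then show ?thesis using that by blast
  qed
  have y: "(snd (P i))\<^sup>2 = poly f (p * t ^ i)" if "i \<ge> 1" for i
  proof -
    have "P i \<in> curve_points f"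
      using assms(3) that idx unfolding geometric_progression_seq_def by simp
    then show ?thesis using x[OF that] by (auto simp: curve_points_def case_prod_unfold)
  qed

  \<comment> \<open>Otherwise three of the points would share their \<open>x\<close>-coordinate, and a curve point is
      determined by it up to the sign of \<open>y\<close>.\<close>
  have not_root_of_unity: "t ^ k \<noteq> 1" if k: "k > 0" for k
  proof
    assume tk: "t ^ k = 1"
    have same: "(snd (P (1 + m * k)))\<^sup>2 = poly f (p * t)" "fst (P (1 + m * k)) = p * t" for m
      using y[of "1 + m * k"] x[of "1 + m * k"] tk
      by (simp_all add: power_add mult.commute[of m k] power_mult)
    let ?y = "\<lambda>m. snd (P (1 + m * k))"
    have neq: "?y m \<noteq> ?y n" if "m \<noteq> n" for m n
    proof
      assume "?y m = ?y n"
      then have "P (1 + m * k) = P (1 + n * k)" using same(2) by (metis prod_eqI)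
      then have "1 + m * k = 1 + n * k" by (rule inj_onD[OF assms(4)]) (auto simp: idx)
      then show False using that k by simp
    qed
    have "(?y m)\<^sup>2 = (?y n)\<^sup>2" for m n using same(1) by simp
    then have opp: "?y m = - ?y n" if "m \<noteq> n" for m n using neq[OF that] by (metis power2_eq_iff)
    have "?y 0 = - ?y 1" "?y 2 = - ?y 1" by (rule opp; simp)+
    then show False using neq[of 0 2] by simp
  qed

  obtain d e coord where "rational_basis d (e :: nat \<Rightarrow> 'a) coord"
    using number_field_imp_rational_basis[OF assms(1)] by blast
  then interpret K: rational_basis d e coord .

  \<comment> \<open>An absolute value \<open>s\<close> with \<open>s t < 1\<close>, obtained from a place where \<open>inverse t\<close> is large.\<close>
  have "\<exists>v\<in>places. K.radius v (inverse t) > 1"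
  proof (rule ccontr)
    assume "\<not> (\<exists>v\<in>places. K.radius v (inverse t) > 1)"
    then obtain k where "k > 0" "inverse t ^ k = 1" using K.kronecker[of "inverse t"] t by force
    then show False using not_root_of_unity[of k] by (simp add: power_inverse)
  qed
  then obtain v where v: "v \<in> places" and big: "K.radius v (inverse t) > 1" by blast
  obtain s where s: "multiplicative_seminorm s" and s_le: "\<And>x. s x \<le> K.radius v x"
    and s_inv: "s (inverse t) = K.radius v (inverse t)"
    using exists_multiplicative_seminorm[OF K.pm_radius[OF v], of "inverse t"] t by auto
  have pm: "power_mult_seminorm s" and mult: "\<And>x y. s (x * y) = s x * s y"
    using s by (auto simp: multiplicative_seminorm_def)
  have "s t * s (inverse t) = 1" using mult[of t "inverse t"] t power_mult_seminormD(2)[OF pm] by simp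
  then have st: "s t < 1"
    using big s_inv pm_pos[OF pm t] mult_strict_left_mono[of 1 "s (inverse t)" "s t"] by simp
  define \<tau> where "\<tau> = t\<^sup>2"
  have tau: "\<tau> \<noteq> 0" "s \<tau> < 1"
    using t st power_mult_seminormD(3,6)[OF pm, of t] by (auto simp: \<tau>_def power_less_one_iff)

  have deg: "degree f \<ge> 3" and sqfree: "rsquarefree (map_poly to_ac f)"
    using assms(2) by (auto simp: hyperelliptic_def)
  obtain m q where f: "f = [:0, 1:] ^ m * q" and q0: "poly q 0 \<noteq> 0"
  proof -
    have "f \<noteq> 0" using deg by auto
    from order_decomp[OF this, of 0] show ?thesis
      using that unfolding poly_eq_0_iff_dvd by auto
  qed

  \<comment> \<open>Pairing consecutive terms turns the constant coefficient into a square.\<close>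
  define g where "g = pcompose q [:0, p:]"
  define h where "h = g * pcompose g [:0, \<tau>:]"
  define W where "W n = snd (P (2 * n)) * snd (P (2 * n + 2)) / (p ^ m * t ^ (m * (2 * n + 1)))" for n
  have W: "(W n)\<^sup>2 = poly h (\<tau> ^ n)" if n: "n \<ge> 1" for n
  proof -
    have t1: "p * t ^ (2 * n) = p * \<tau> ^ n" and t2: "p * t ^ (2 * n + 2) = p * (\<tau> * \<tau> ^ n)"
      unfolding \<tau>_def power_add power_mult by (simp_all only: mult.commute)
    have "(snd (P (2 * n)) * snd (P (2 * n + 2)))\<^sup>2 =
        poly f (p * \<tau> ^ n) * poly f (p * (\<tau> * \<tau> ^ n))"
      using y[of "2 * n"] y[of "2 * n + 2"] n unfolding power_mult_distrib t1 t2 by simp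
    also have "\<dots> = (p * \<tau> ^ n) ^ m * (p * (\<tau> * \<tau> ^ n)) ^ m * poly h (\<tau> ^ n)"
      by (simp add: f h_def g_def poly_pcompose mult_ac)
    also have "(p * \<tau> ^ n) ^ m * (p * (\<tau> * \<tau> ^ n)) ^ m = (p ^ m * t ^ (m * (2 * n + 1)))\<^sup>2"
    proof -
      have "(p * \<tau> ^ n) * (p * (\<tau> * \<tau> ^ n)) = (p * t ^ (2 * n + 1))\<^sup>2"
        by (simp add: \<tau>_def power2_eq_square power_add mult_2 mult_2_right power_mult_distrib mult_ac)
      then have "(p * \<tau> ^ n) ^ m * (p * (\<tau> * \<tau> ^ n)) ^ m = ((p * t ^ (2 * n + 1))\<^sup>2) ^ m"
        by (simp only: power_mult_distrib[symmetric])
      also have "\<dots> = ((p * t ^ (2 * n + 1)) ^ m)\<^sup>2"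
        by (simp only: power_mult[symmetric] mult.commute)
      also have "(p * t ^ (2 * n + 1)) ^ m = p ^ m * t ^ (m * (2 * n + 1))"
        by (simp only: power_mult_distrib power_mult[symmetric] mult.commute)
      finally show ?thesis .
    qed
    finally show ?thesis using p t by (simp add: W_def power_divide)
  qed
  have "\<exists>T. h = T\<^sup>2"
  proof (rule K.square_values_imp_square[OF v s s_le tau, of "poly q 0"])
    show "poly h 0 = (poly q 0)\<^sup>2" by (simp add: h_def g_def poly_pcompose power2_eq_square)
  qed (use q0 W in auto)
  then obtain T where T: "h = T\<^sup>2" by blast

  interpret ac: comm_ring_hom "to_ac :: 'a \<Rightarrow> 'a alg_closure" by (rule to_ac_comm_ring_hom)
  interpret mac: map_poly_comm_ring_hom "to_ac :: 'a \<Rightarrow> 'a alg_closure" ..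
  let ?F = "map_poly to_ac f" and ?Q = "map_poly to_ac q" and ?G = "map_poly to_ac g"
  have F: "?F = [:0, 1:] ^ m * ?Q" unfolding f by (simp add: hom_distribs)
  have noroot: "\<not> (poly ?F x = 0 \<and> poly (pderiv ?F) x = 0)" for x
    using sqfree rsquarefree_roots by blast
  have m1: "m \<le> 1"
  proof (rule ccontr)
    assume "\<not> m \<le> 1"
    then obtain j where "m = Suc (Suc j)" using less_imp_Suc_add[of 1 m] by auto
    then have "?F = [:0, 1:] * ([:0, 1:] * ([:0, 1:] ^ j * ?Q))"
      unfolding F by (simp only: power_Suc mult.assoc)
    then show False using noroot[of 0] by (simp add: pderiv_pCons)
  qed
  have Q0: "poly ?Q 0 \<noteq> 0" using q0 by simp
  have simpleQ: "poly (pderiv ?Q) x \<noteq> 0" if Qx: "poly ?Q x = 0" for x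
  proof
    assume "poly (pderiv ?Q) x = 0"
    then have "poly (pderiv ?F) x = 0" using Qx unfolding F by (simp add: pderiv_mult)
    then show False using noroot[of x] Qx unfolding F by simp
  qed
  have linear: "map_poly to_ac [:0, a:] = [:0, to_ac a:]" for a :: 'a
    by (rule poly_eqI) (simp add: coeff_map_poly coeff_pCons split: nat.split)
  have G: "?G = pcompose ?Q [:0, to_ac p:]" unfolding g_def by (simp only: ac.map_poly_pcompose linear)
  have "degree q > 0"
  proof -
    have "degree f \<le> m * 1 + degree q"
      unfolding f using degree_mult_le[of "[:0, 1:] ^ m" q] degree_power_le[of "[:0, 1:] :: 'a poly" m] by simp
    then show ?thesis using deg m1 by simp
  qed
  then have "degree ?G > 0" unfolding G using p by (simp add: degree_pcompose degree_map_poly)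
  moreover have "poly ?G 0 \<noteq> 0" unfolding G using Q0 by (simp add: poly_pcompose)
  moreover have "poly (pderiv ?G) x \<noteq> 0" if "poly ?G x = 0" for x
    using simpleQ[of "to_ac p * x"] that p unfolding G
    by (simp add: poly_pcompose pderiv_pcompose pderiv_pCons mult.commute)
  moreover have "?G * pcompose ?G [:0, to_ac \<tau>:] = (map_poly to_ac T)\<^sup>2"
  proof -
    have "map_poly to_ac h = ?G * pcompose ?G [:0, to_ac \<tau>:]"
      unfolding h_def by (simp only: mac.hom_mult ac.map_poly_pcompose linear)
    then show ?thesis unfolding T by (simp add: hom_distribs)
  qed
  ultimately obtain k where k: "k > 0" "to_ac \<tau> ^ k = 1"
    using product_with_dilation_square_imp_root_of_unity[of ?G "to_ac \<tau>"] tau(1) by auto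
  then have "to_ac (t ^ (2 * k)) = to_ac 1" by (simp add: \<tau>_def power_mult)
  then have "t ^ (2 * k) = 1" by (simp only: to_ac_eq_iff)
  then show False using not_root_of_unity[of "2 * k"] k(1) by simp
qed

end
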